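(* Let $k,l\ge 1$, let $\bar f\colon X\to \mathrm{BPU}(k)$ be a continuous map and let $A_k=\bar f^*(A_k^{univ})$ be the $M_k(\mathbb C)$-bundle over $X$ classified by $\bar f$. Then there is a natural one-to-one correspondence between fiberwise embeddings $\mu\colon A_k\to X\times M_{kl}(\mathbb C)$ over $X$ (continuous maps over $X$ whose restriction to every fiber $(A_k)_x\to M_{kl}(\mathbb C)$ is a unital $*$-homomorphism) and lifts $\widetilde f\colon X\to \mathrm H_{k,l}(A_k^{univ})$ of $\bar f$ in the fibration $p_{k,l}\colon \mathrm H_{k,l}(A_k^{univ})\to \mathrm{BPU}(k)$, i.e. continuous maps with $p_{k,l}\circ\widetilde f=\bar f$.
   Context: $X$ is a compact manifold (or a finite CW complex). $\mathrm{PU}(k)$ is the projective unitary group, identified with the group of $*$-automorphisms of the complex matrix algebra $M_k(\mathbb C)$. An $M_k(\mathbb C)$-bundle is a locally trivial bundle with fiber $M_k(\mathbb C)$ and structure group $\mathrm{PU}(k)$; $A_k^{univ}\to\mathrm{BPU}(k)$ is the universal one. $\mathrm{Fr}_{k,l}=\mathrm{Hom}_{alg}(M_k(\mathbb C),M_{kl}(\mathbb C))$ is the space of unital $*$-homomorphisms, homeomorphic to $\mathrm{PU}(kl)/(E_k\otimes \mathrm{PU}(l))$, where $E_k$ is the unit $k\times k$ matrix. Applying the functor $\mathrm{Hom}_{alg}(-,M_{kl}(\mathbb C))$ fiberwise to $A_k^{univ}$ gives the fibration $p_{k,l}\colon \mathrm H_{k,l}(A_k^{univ})\to\mathrm{BPU}(k)$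 with fiber $\mathrm{Fr}_{k,l}$; the fiber over $x\in \mathrm{BPU}(k)$ is the space of unital $*$-homomorphisms $(A_k^{univ})_x\to M_{kl}(\mathbb C)$. Equivalently $\mathrm H_{k,l}(A_k^{univ})=\mathrm{EPU}(k)\times_{\mathrm{PU}(k)}\mathrm{Fr}_{k,l}$. *)

theory Defs
  imports
    "HOL-Analysis.Analysis"
    "HOL-Algebra.Module"
begin

definition half_space :: "nat \<Rightarrow> (nat \<Rightarrow> real) topology" where
  "half_space n = subtopology (Euclidean_space n) {x. 0 \<le> x 0}"

text \<open>Topological manifolds, possibly with boundary: an open subset of Euclidean space is
  homeomorphic to an open subset of the half-space. Second countability follows from compactness.\<close>

definition compact_manifold :: "'a topology \<Rightarrow> bool" where
  "compact_manifold X \<longleftrightarrow>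
     compact_space X \<and> Hausdorff_space X \<and>
     (\<exists>n. \<forall>x\<in>topspace X. \<exists>U V. openin X U \<and> x \<in> U \<and> openin (half_space n) V \<and>
        subtopology X U homeomorphic_space subtopology (half_space n) V)"

definition disc :: "nat \<Rightarrow> (nat \<Rightarrow> real) topology" where
  "disc n = subtopology (Euclidean_space n) {x. (\<Sum>i<n. (x i)\<^sup>2) \<le> 1}"

definition disc_interior :: "nat \<Rightarrow> (nat \<Rightarrow> real) set" where
  "disc_interior n = {x \<in> topspace (disc n). (\<Sum>i<n. (x i)\<^sup>2) < 1}"

definition disc_boundary :: "nat \<Rightarrow> (nat \<Rightarrow> real) set" where
  "disc_boundary n = {x \<in> topspace (disc n). (\<Sum>i<n. (x i)\<^sup>2) = 1}"

text \<open>There are \<open>m\<close> cells; cell \<open>i\<close> has dimension \<open>d i\<close> and characteristic map \<open>\<phi> i\<close>.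
  For finitely many cells in a Hausdorff space, the weak topology condition is automatic, and so
  is the fact that \<open>\<phi> i\<close> is a homeomorphism from the open disc onto the open cell.\<close>

definition finite_CW_complex :: "'a topology \<Rightarrow> bool" where
  "finite_CW_complex X \<longleftrightarrow>
     Hausdorff_space X \<and>
     (\<exists>m d \<phi>.
        (\<forall>i<m::nat. continuous_map (disc (d i)) X (\<phi> i)) \<and>
        (\<forall>i<m. inj_on (\<phi> i) (disc_interior (d i))) \<and>
        disjoint_family_on (\<lambda>i. \<phi> i ` disc_interior (d i)) {..<m} \<and>
        topspace X = (\<Union>i<m. \<phi> i ` disc_interior (d i)) \<and>
        (\<forall>i<m. \<phi> i ` disc_boundary (d i) \<subseteq>
           (\<Union>j\<in>{j. j < m \<and> d j < d i}. \<phi> j ` disc_interior (d j))))"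

record 'a star_algebra = "(complex, 'a) module" +
  star :: "'a \<Rightarrow> 'a"

text \<open>Members of \<open>ring_hom\<close> preserve the unit.\<close>

definition star_hom :: "'a star_algebra \<Rightarrow> 'b star_algebra \<Rightarrow> ('a \<Rightarrow> 'b) set" where
  "star_hom A B =
     {h \<in> ring_hom A B.
        (\<forall>z. \<forall>a\<in>carrier A. h (z \<odot>\<^bsub>A\<^esub> a) = z \<odot>\<^bsub>B\<^esub> h a) \<and>
        (\<forall>a\<in>carrier A. h (star A a) = star B (h a))}"

type_synonym 'n cmat = "complex ^ 'n ^ 'n"

definition cmat_scale :: "complex \<Rightarrow> 'n::finite cmat \<Rightarrow> 'n cmat" where
  "cmat_scale z a = (\<chi> i j. z * a $ i $ j)"

definition cmat_star :: "'n::finite cmat \<Rightarrow> 'n cmat" where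
  "cmat_star a = (\<chi> i j. cnj (a $ j $ i))"

definition matrix_algebra :: "'n::finite cmat star_algebra" where
  "matrix_algebra =
     \<lparr>carrier = UNIV, mult = (**), one = mat 1, zero = 0, add = (+),
      smult = cmat_scale, star = cmat_star\<rparr>"

text \<open>Since matrix algebras are finite-dimensional, every homomorphism is a bounded (real-)linear
  map, and the operator norm topology on these sets is that of pointwise convergence.\<close>

definition Fr :: "('k::finite cmat \<Rightarrow>\<^sub>L 'n::finite cmat) set" where
  "Fr = {h. blinfun_apply h \<in> star_hom matrix_algebra matrix_algebra}"

text \<open>The projective unitary group, identified with the group of *-automorphisms of the matrix
  algebra: the class of a unitary matrix \<open>u\<close> is the automorphism \<open>a \<mapsto> u a u\<^sup>*\<close>.\<close>

definition PU :: "('k::finite cmat \<Rightarrow>\<^sub>L 'k cmat) monoid" where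
  "PU = \<lparr>carrier = {g \<in> Fr. bij (blinfun_apply g)}, mult = (o\<^sub>L), one = id_blinfun\<rparr>"

definition quotient_topology :: "'a topology \<Rightarrow> ('a \<Rightarrow> 'b) \<Rightarrow> 'b topology" where
  "quotient_topology X q =
     topology (\<lambda>U. U \<subseteq> q ` topspace X \<and> openin X {x \<in> topspace X. q x \<in> U})"

lemma openin_quotient_topology:
  "openin (quotient_topology X q) U \<longleftrightarrow>
     U \<subseteq> q ` topspace X \<and> openin X {x \<in> topspace X. q x \<in> U}"
proof -
  have "istopology (\<lambda>U. U \<subseteq> q ` topspace X \<and> openin X {x \<in> topspace X. q x \<in> U})"
    unfolding istopology_def
  proof (intro conjI allI impI)
    fix S T
    assume S: "S \<subseteq> q ` topspace X \<and> openin X {x \<in> topspace X. q x \<in> S}"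
      and T: "T \<subseteq> q ` topspace X \<and> openin X {x \<in> topspace X. q x \<in> T}"
    have "{x \<in> topspace X. q x \<in> S \<inter> T} = {x \<in> topspace X. q x \<in> S} \<inter> {x \<in> topspace X. q x \<in> T}"
      by auto
    then show "openin X {x \<in> topspace X. q x \<in> S \<inter> T}"
      using S T by (simp only: openin_Int)
    show "S \<inter> T \<subseteq> q ` topspace X"
      using S by auto
  next
    fix \<K>
    assume K: "\<forall>K\<in>\<K>. K \<subseteq> q ` topspace X \<and> openin X {x \<in> topspace X. q x \<in> K}"
    have "{x \<in> topspace X. q x \<in> \<Union>\<K>} = (\<Union>K\<in>\<K>. {x \<in> topspace X. q x \<in> K})"
      by auto
    then show "openin X {x \<in> topspace X. q x \<in> \<Union>\<K>}"
      using K by (auto intro: openin_Union)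
    show "\<Union>\<K> \<subseteq> q ` topspace X"
      using K by auto
  qed
  then show ?thesis
    unfolding quotient_topology_def by (simp add: topology_inverse')
qed

lemma topspace_quotient_topology: "topspace (quotient_topology X q) = q ` topspace X"
proof
  show "topspace (quotient_topology X q) \<subseteq> q ` topspace X"
    using openin_topspace[of "quotient_topology X q"] unfolding openin_quotient_topology by blast
  have "{x \<in> topspace X. q x \<in> q ` topspace X} = topspace X"
    by auto
  then have "openin (quotient_topology X q) (q ` topspace X)"
    by (simp add: openin_quotient_topology)
  then show "q ` topspace X \<subseteq> topspace (quotient_topology X q)"
    by (rule openin_subset)
qed

lemma quotient_map_quotient_topology: "quotient_map X (quotient_topology X q) q"
  by (simp add: quotient_map_def topspace_quotient_topology openin_quotient_topology)

record ('g, 'e, 'b) right_bundle =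
  tot :: "'e topology"
  bas :: "'b topology"
  prj :: "'e \<Rightarrow> 'b"
  act :: "'e \<Rightarrow> 'g \<Rightarrow> 'e"

definition principal_bundle ::
    "('g::topological_space) monoid \<Rightarrow> ('g, 'e, 'b) right_bundle \<Rightarrow> bool" where
  "principal_bundle G P \<longleftrightarrow>
     continuous_map (tot P) (bas P) (prj P) \<and>
     continuous_map (prod_topology (tot P) (top_of_set (carrier G))) (tot P)
       (\<lambda>(e, g). act P e g) \<and>
     (\<forall>e\<in>topspace (tot P). act P e \<one>\<^bsub>G\<^esub> = e) \<and>
     (\<forall>e\<in>topspace (tot P). \<forall>g\<in>carrier G. \<forall>h\<in>carrier G.
        act P e (g \<otimes>\<^bsub>G\<^esub> h) = act P (act P e g) h) \<and>
     (\<forall>b\<in>topspace (bas P). \<exists>U \<Psi>. openin (bas P) U \<and> b \<in> U \<and>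
        homeomorphic_map
          (prod_topology (subtopology (bas P) U) (top_of_set (carrier G)))
          (subtopology (tot P) {e \<in> topspace (tot P). prj P e \<in> U}) \<Psi> \<and>
        (\<forall>x\<in>U. \<forall>g\<in>carrier G. prj P (\<Psi> (x, g)) = x \<and>
           (\<forall>h\<in>carrier G. \<Psi> (x, g \<otimes>\<^bsub>G\<^esub> h) = act P (\<Psi> (x, g)) h)))"

text \<open>\<open>EG \<rightarrow> BG\<close> is only determined up to homotopy equivalence; it is any principal bundle with
  contractible total space. (The library counts the empty space as contractible.)\<close>

definition universal_bundle ::
    "('g::topological_space) monoid \<Rightarrow> ('g, 'e, 'b) right_bundle \<Rightarrow> bool" where
  "universal_bundle G P \<longleftrightarrow>
     principal_bundle G P \<and> topspace (tot P) \<noteq> {} \<and> contractible_space (tot P)"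

text \<open>The class \<open>[e, y]\<close> in \<open>E \<times>\<^sub>G F\<close>, for a left action \<open>a\<close> of \<open>G\<close> on \<open>F\<close>: the orbit of
  \<open>(e, y)\<close> under \<open>(e, y) \<cdot> g = (e g, g\<^sup>-\<^sup>1 y)\<close>.\<close>

definition assoc_class ::
    "'g monoid \<Rightarrow> ('g, 'e, 'b) right_bundle \<Rightarrow> ('g \<Rightarrow> 'f \<Rightarrow> 'f) \<Rightarrow> 'e \<times> 'f \<Rightarrow> ('e \<times> 'f) set" where
  "assoc_class G P a = (\<lambda>(e, y). {(act P e g, a (inv\<^bsub>G\<^esub> g) y) |g. g \<in> carrier G})"

definition assoc_space ::
    "'g monoid \<Rightarrow> ('g, 'e, 'b) right_bundle \<Rightarrow> 'f topology \<Rightarrow> ('g \<Rightarrow> 'f \<Rightarrow> 'f)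
      \<Rightarrow> ('e \<times> 'f) set topology" where
  "assoc_space G P F a = quotient_topology (prod_topology (tot P) F) (assoc_class G P a)"

definition assoc_prj :: "('g, 'e, 'b) right_bundle \<Rightarrow> ('e \<times> 'f) set \<Rightarrow> 'b" where
  "assoc_prj P u = the_elem ((\<lambda>z. prj P (fst z)) ` u)"

type_synonym ('k, 'e, 'b) PU_bundle = "('k cmat \<Rightarrow>\<^sub>L 'k cmat, 'e, 'b) right_bundle"

definition A_univ :: "('k::finite, 'e, 'b) PU_bundle \<Rightarrow> ('e \<times> 'k cmat) set topology" where
  "A_univ P = assoc_space PU P euclidean blinfun_apply"

text \<open>The *-algebra structure of the fibre over \<open>b\<close>, given on representatives with a common first
  component, e.g. \<open>[e, a] [e, a'] = [e, a a']\<close>. As \<open>PU\<close> acts freely and transitively on the fibre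
  of \<open>P\<close> over \<open>b\<close>, every class over \<open>b\<close> has exactly one representative for each \<open>e\<close> over \<open>b\<close>.\<close>

definition A_fibre ::
    "('k::finite, 'e, 'b) PU_bundle \<Rightarrow> 'b \<Rightarrow> ('e \<times> 'k cmat) set star_algebra" where
  "A_fibre P b =
     \<lparr>carrier = {c \<in> topspace (A_univ P). assoc_prj P c = b},
      mult = (\<lambda>c c'. {(e, a ** a') |e a a'. (e, a) \<in> c \<and> (e, a') \<in> c'}),
      one = {(e, mat 1) |e. e \<in> topspace (tot P) \<and> prj P e = b},
      zero = {(e, 0) |e. e \<in> topspace (tot P) \<and> prj P e = b},
      add = (\<lambda>c c'. {(e, a + a') |e a a'. (e, a) \<in> c \<and> (e, a') \<in> c'}),
      smult = (\<lambda>z c. {(e, cmat_scale z a) |e a. (e, a) \<in> c}),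
      star = (\<lambda>c. {(e, cmat_star a) |e a. (e, a) \<in> c})\<rparr>"

text \<open>\<open>EPU(k) \<times>\<^bsub>PU(k)\<^esub> Fr\<close>, where \<open>g\<close> acts on \<open>Fr\<close> by \<open>h \<mapsto> h \<circ> g\<^sup>-\<^sup>1\<close>; the projection to
  \<open>BPU(k)\<close> is \<open>assoc_prj P\<close>.\<close>

definition H_univ ::
    "('k::finite, 'e, 'b) PU_bundle \<Rightarrow> ('e \<times> ('k cmat \<Rightarrow>\<^sub>L 'n::finite cmat)) set topology" where
  "H_univ P = assoc_space PU P (top_of_set Fr) (\<lambda>g h. h o\<^sub>L inv\<^bsub>PU\<^esub> g)"

text \<open>A point \<open>[e, h]\<close> of \<open>H_univ P\<close> over \<open>b\<close>, viewed as a homomorphism from the fibre of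
  \<open>A_univ P\<close> over \<open>b\<close>: it maps \<open>[e, a]\<close> to \<open>h a\<close>.\<close>

definition H_eval ::
    "('e \<times> ('k::finite cmat \<Rightarrow>\<^sub>L 'n::finite cmat)) set \<Rightarrow> ('e \<times> 'k cmat) set \<Rightarrow> 'n cmat" where
  "H_eval u c = the_elem {blinfun_apply h a |e h a. (e, h) \<in> u \<and> (e, a) \<in> c}"

definition A_pullback ::
    "('k::finite, 'e, 'b) PU_bundle \<Rightarrow> 'x topology \<Rightarrow> ('x \<Rightarrow> 'b)
      \<Rightarrow> ('x \<times> ('e \<times> 'k cmat) set) topology" where
  "A_pullback P X f =
     subtopology (prod_topology X (A_univ P)) {(x, c). f x = assoc_prj P c}"

text \<open>The fibre of the pullback over \<open>x\<close> is \<open>{x}\<close> times the fibre of \<open>A_univ P\<close> over \<open>f x\<close>, with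
  the algebra structure of the second factor. Maps are made extensional (\<open>undefined\<close> outside the
  space in question), so that equality of members of these sets is equality of maps.\<close>

definition fibrewise_embeddings ::
    "('k::finite, 'e, 'b) PU_bundle \<Rightarrow> 'x topology \<Rightarrow> ('x \<Rightarrow> 'b)
      \<Rightarrow> ('x \<times> ('e \<times> 'k cmat) set \<Rightarrow> 'x \<times> 'n::finite cmat) set" where
  "fibrewise_embeddings P X f =
     {\<mu> \<in> extensional (topspace (A_pullback P X f)).
        continuous_map (A_pullback P X f) (prod_topology X euclidean) \<mu> \<and>
        (\<forall>z\<in>topspace (A_pullback P X f). fst (\<mu> z) = fst z) \<and>
        (\<forall>x\<in>topspace X. (\<lambda>c. snd (\<mu> (x, c))) \<in> star_hom (A_fibre P (f x)) matrix_algebra)}"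

definition lifts ::
    "('k::finite, 'e, 'b) PU_bundle \<Rightarrow> 'x topology \<Rightarrow> ('x \<Rightarrow> 'b)
      \<Rightarrow> ('x \<Rightarrow> ('e \<times> ('k cmat \<Rightarrow>\<^sub>L 'n::finite cmat)) set) set" where
  "lifts P X f =
     {F \<in> extensional (topspace X).
        continuous_map X (H_univ P) F \<and> (\<forall>x\<in>topspace X. assoc_prj P (F x) = f x)}"

definition embedding_of_lift ::
    "('k::finite, 'e, 'b) PU_bundle \<Rightarrow> 'x topology \<Rightarrow> ('x \<Rightarrow> 'b)
      \<Rightarrow> ('x \<Rightarrow> ('e \<times> ('k cmat \<Rightarrow>\<^sub>L 'n::finite cmat)) set)
      \<Rightarrow> 'x \<times> ('e \<times> 'k cmat) set \<Rightarrow> 'x \<times> 'n cmat" where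
  "embedding_of_lift P X f F =
     restrict (\<lambda>(x, c). (x, H_eval (F x) c)) (topspace (A_pullback P X f))"

text \<open>The pullback along \<open>\<phi> : Y \<rightarrow> X\<close> of the pullback bundle over \<open>X\<close> is identified with the pullback
  along \<open>f \<circ> \<phi>\<close>: the point \<open>(y, c)\<close> corresponds to \<open>(\<phi> y, c)\<close>.\<close>

definition pullback_embedding ::
    "('k::finite, 'e, 'b) PU_bundle \<Rightarrow> 'y topology \<Rightarrow> ('x \<Rightarrow> 'b) \<Rightarrow> ('y \<Rightarrow> 'x)
      \<Rightarrow> ('x \<times> ('e \<times> 'k cmat) set \<Rightarrow> 'x \<times> 'n::finite cmat)
      \<Rightarrow> 'y \<times> ('e \<times> 'k cmat) set \<Rightarrow> 'y \<times> 'n cmat" where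
  "pullback_embedding P Y f \<phi> \<mu> =
     restrict (\<lambda>(y, c). (y, snd (\<mu> (\<phi> y, c)))) (topspace (A_pullback P Y (f \<circ> \<phi>)))"

end

theory Submission
  imports Defs
begin

text \<open>
A point of \<open>H_univ P\<close> over \<open>b\<close> is a class \<open>[e, h]\<close> with \<open>e\<close> over \<open>b\<close> and \<open>h \<in> Fr\<close>, and a point of
\<open>A_univ P\<close> over \<open>b\<close> is a class \<open>[e, a]\<close> with a matrix \<open>a\<close>. Evaluation \<open>[e, h] [e, a] = h a\<close> does not
depend on \<open>e\<close>, since \<open>PU\<close> acts on the two sides in opposite ways (\<open>H_eval_class\<close>). Fixing \<open>e\<close>
identifies the fibre of \<open>A_univ P\<close> over \<open>b\<close> with the matrix algebra (\<open>star_hom_A_fibre_iff\<close>), so that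
the points of \<open>H_univ P\<close> over \<open>b\<close> are exactly the unital *-homomorphisms from this fibre. Hence a
choice of a point over \<open>f x\<close> for every \<open>x\<close> is the same as a choice of a homomorphism on every fibre
of the pullback, and the whole content of the theorem is that the two notions of continuity agree.

This is a local question. Over an open set \<open>U\<close> of the base on which \<open>P\<close> has a section \<open>s\<close>, every class
of an associated bundle can be written as \<open>[s b, y]\<close>, where \<open>y\<close> is unique and depends continuously on
the class (\<open>fibre_coordinate\<close>). With the same \<open>s\<close> for both bundles, a lift becomes a map \<open>x \<mapsto> h x\<close> to
\<open>Fr\<close>, and the embedding becomes \<open>(x, a) \<mapsto> h x a\<close>. Joint continuity of the latter follows from that of
evaluation (\<open>continuous_map_H_eval\<close>); conversely, continuity in \<open>x\<close> for each fixed \<open>a\<close> gives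
continuity of \<open>h\<close> in the operator norm, as matrix algebras have finite dimension
(\<open>continuous_map_lift_of_embedding\<close>). Naturality in \<open>X\<close> holds because everything is defined pointwise.
\<close>

section \<open>Principal bundles\<close>

locale principal = group G for G :: "('g::topological_space) monoid" (structure) +
  fixes P :: "('g, 'e, 'b) right_bundle"
  assumes principal_bundle: "principal_bundle G P"
begin

text \<open>The inverse \<open>\<Phi>\<close> of a local trivialization \<open>\<Psi>\<close> is recorded together with \<open>\<Psi>\<close>: its second component
  is the coordinate along the fibre.\<close>

lemma trivialization:
  assumes b: "b \<in> topspace (bas P)"
  obtains U \<Psi> \<Phi> where "openin (bas P) U" "b \<in> U"
    "homeomorphic_maps (prod_topology (subtopology (bas P) U) (top_of_set (carrier G)))
       (subtopology (tot P) {e \<in> topspace (tot P). prj P e \<in> U}) \<Psi> \<Phi>"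
    "\<And>x g. x \<in> U \<Longrightarrow> g \<in> carrier G \<Longrightarrow> prj P (\<Psi> (x, g)) = x"
    "\<And>x g h. x \<in> U \<Longrightarrow> g \<in> carrier G \<Longrightarrow> h \<in> carrier G \<Longrightarrow>
       \<Psi> (x, g \<otimes> h) = act P (\<Psi> (x, g)) h"
    "\<And>x g. x \<in> U \<Longrightarrow> g \<in> carrier G \<Longrightarrow> \<Phi> (\<Psi> (x, g)) = (x, g)"
    "\<And>e. e \<in> topspace (tot P) \<Longrightarrow> prj P e \<in> U \<Longrightarrow>
       snd (\<Phi> e) \<in> carrier G \<and> e = \<Psi> (prj P e, snd (\<Phi> e))"
proof -
  from principal_bundle b obtain U \<Psi> where U: "openin (bas P) U" "b \<in> U"
    and hom: "homeomorphic_map (prod_topology (subtopology (bas P) U) (top_of_set (carrier G)))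
       (subtopology (tot P) {e \<in> topspace (tot P). prj P e \<in> U}) \<Psi>"
    and \<Psi>: "\<forall>x\<in>U. \<forall>g\<in>carrier G. prj P (\<Psi> (x, g)) = x \<and>
           (\<forall>h\<in>carrier G. \<Psi> (x, g \<otimes> h) = act P (\<Psi> (x, g)) h)"
    unfolding principal_bundle_def by blast
  let ?EU = "subtopology (tot P) {e \<in> topspace (tot P). prj P e \<in> U}"
  let ?UG = "prod_topology (subtopology (bas P) U) (top_of_set (carrier G))"
  obtain \<Phi> where \<Phi>: "homeomorphic_maps ?UG ?EU \<Psi> \<Phi>"
    using hom unfolding homeomorphic_map_maps by blast
  have coord: "snd (\<Phi> e) \<in> carrier G \<and> e = \<Psi> (prj P e, snd (\<Phi> e))"
    if e: "e \<in> topspace (tot P)" "prj P e \<in> U" for e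
  proof -
    obtain x k where xk: "\<Phi> e = (x, k)" by fastforce
    have eEU: "e \<in> topspace ?EU" using e by simp
    then have "\<Phi> e \<in> topspace ?UG"
      using \<Phi> unfolding homeomorphic_maps_def continuous_map_def by blast
    then have x: "x \<in> U" "k \<in> carrier G" using xk by auto
    have "\<Psi> (\<Phi> e) = e" using \<Phi> eEU unfolding homeomorphic_maps_def by blast
    then have "e = \<Psi> (x, k)" using xk by simp
    then show ?thesis using x \<Psi> xk by auto
  qed
  have inj: "\<Phi> (\<Psi> (x, g)) = (x, g)" if "x \<in> U" "g \<in> carrier G" for x g
    using \<Phi> that openin_subset[OF U(1)] unfolding homeomorphic_maps_def by auto
  show ?thesis
    by (rule that[OF U \<Phi> _ _ inj coord]) (use \<Psi> in auto)
qed

lemma act_in: "e \<in> topspace (tot P) \<Longrightarrow> g \<in> carrier G \<Longrightarrow> act P e g \<in> topspace (tot P)"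
proof -
  assume "e \<in> topspace (tot P)" "g \<in> carrier G"
  then have "(e, g) \<in> topspace (prod_topology (tot P) (top_of_set (carrier G)))" by simp
  moreover have "continuous_map (prod_topology (tot P) (top_of_set (carrier G))) (tot P)
       (\<lambda>(e, g). act P e g)"
    using principal_bundle unfolding principal_bundle_def by (elim conjE)
  ultimately have "(\<lambda>(e, g). act P e g) (e, g) \<in> topspace (tot P)"
    using continuous_map_image_subset_topspace by blast
  then show ?thesis by simp
qed

lemma act_one: "e \<in> topspace (tot P) \<Longrightarrow> act P e \<one> = e"
  using principal_bundle unfolding principal_bundle_def by (elim conjE) (erule bspec)

lemma act_mult:
  "e \<in> topspace (tot P) \<Longrightarrow> g \<in> carrier G \<Longrightarrow> h \<in> carrier G \<Longrightarrow>
     act P e (g \<otimes> h) = act P (act P e g) h"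
  using principal_bundle unfolding principal_bundle_def by (elim conjE) simp

lemma continuous_map_prj: "continuous_map (tot P) (bas P) (prj P)"
  using principal_bundle unfolding principal_bundle_def by (elim conjE)

lemma prj_in: "e \<in> topspace (tot P) \<Longrightarrow> prj P e \<in> topspace (bas P)"
  using continuous_map_prj by (auto simp: continuous_map_def)

lemma act_prj:
  assumes e: "e \<in> topspace (tot P)" and g: "g \<in> carrier G"
  shows "prj P (act P e g) = prj P e"
proof -
  obtain U \<Psi> and \<Phi> :: "'e \<Rightarrow> 'b \<times> 'g" where U: "prj P e \<in> U"
    and pr: "\<And>x g. x \<in> U \<Longrightarrow> g \<in> carrier G \<Longrightarrow> prj P (\<Psi> (x, g)) = x"
    and eq: "\<And>x g h. x \<in> U \<Longrightarrow> g \<in> carrier G \<Longrightarrow> h \<in> carrier G \<Longrightarrow>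
       \<Psi> (x, g \<otimes> h) = act P (\<Psi> (x, g)) h"
    and coord: "\<And>e. e \<in> topspace (tot P) \<Longrightarrow> prj P e \<in> U \<Longrightarrow>
       snd (\<Phi> e) \<in> carrier G \<and> e = \<Psi> (prj P e, snd (\<Phi> e))"
    by (rule trivialization[OF prj_in[OF e]]) blast
  have k: "snd (\<Phi> e) \<in> carrier G" "e = \<Psi> (prj P e, snd (\<Phi> e))" using coord e U by auto
  have "act P e g = \<Psi> (prj P e, snd (\<Phi> e) \<otimes> g)" using eq[OF U k(1) g] k(2) by simp
  then show ?thesis using pr[OF U] k g by simp
qed

text \<open>A trivialization identifies a fibre with \<open>G\<close> acting on itself by right translations.\<close>

lemma act_transitive:
  assumes e: "e \<in> topspace (tot P)" "e' \<in> topspace (tot P)" and ee': "prj P e = prj P e'"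
  obtains g where "g \<in> carrier G" "e' = act P e g"
proof -
  obtain U \<Psi> and \<Phi> :: "'e \<Rightarrow> 'b \<times> 'g" where U: "prj P e \<in> U"
    and eq: "\<And>x g h. x \<in> U \<Longrightarrow> g \<in> carrier G \<Longrightarrow> h \<in> carrier G \<Longrightarrow>
       \<Psi> (x, g \<otimes> h) = act P (\<Psi> (x, g)) h"
    and coord: "\<And>e. e \<in> topspace (tot P) \<Longrightarrow> prj P e \<in> U \<Longrightarrow>
       snd (\<Phi> e) \<in> carrier G \<and> e = \<Psi> (prj P e, snd (\<Phi> e))"
    by (rule trivialization[OF prj_in[OF e(1)]]) blast
  define k k' where kk'_def: "k = snd (\<Phi> e)" "k' = snd (\<Phi> e')"
  have k: "k \<in> carrier G" "e = \<Psi> (prj P e, k)" using coord e U unfolding kk'_def by auto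
  have k': "k' \<in> carrier G" "e' = \<Psi> (prj P e, k')"
    using coord[of e'] e U ee' unfolding kk'_def by auto
  have "k \<otimes> (inv k \<otimes> k') = k'" using k k' by (simp add: m_assoc[symmetric])
  then have "e' = act P e (inv k \<otimes> k')"
    using eq[OF U k(1), of "inv k \<otimes> k'"] k k' by simp
  then show ?thesis using k k' by (intro that[of "inv k \<otimes> k'"]) simp_all
qed

text \<open>In a trivialization a fixed point of \<open>g\<close> reads \<open>k \<otimes> g = k\<close>.\<close>

lemma act_free:
  assumes e: "e \<in> topspace (tot P)" and g: "g \<in> carrier G" and fixed: "act P e g = e"
  shows "g = \<one>"
proof -
  obtain U \<Psi> and \<Phi> :: "'e \<Rightarrow> 'b \<times> 'g" where U: "prj P e \<in> U"
    and eq: "\<And>x g h. x \<in> U \<Longrightarrow> g \<in> carrier G \<Longrightarrow> h \<in> carrier G \<Longrightarrow>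
       \<Psi> (x, g \<otimes> h) = act P (\<Psi> (x, g)) h"
    and inj: "\<And>x g. x \<in> U \<Longrightarrow> g \<in> carrier G \<Longrightarrow> \<Phi> (\<Psi> (x, g)) = (x, g)"
    and coord: "\<And>e. e \<in> topspace (tot P) \<Longrightarrow> prj P e \<in> U \<Longrightarrow>
       snd (\<Phi> e) \<in> carrier G \<and> e = \<Psi> (prj P e, snd (\<Phi> e))"
    by (rule trivialization[OF prj_in[OF e]]) blast
  define k where "k = snd (\<Phi> e)"
  have k: "k \<in> carrier G" "e = \<Psi> (prj P e, k)" using coord e U unfolding k_def by auto
  have "\<Phi> e = (prj P e, k \<otimes> g)"
    using eq[OF U k(1) g] inj[OF U, of "k \<otimes> g"] k g fixed by simp
  then have "k = k \<otimes> g" by (metis k_def snd_conv)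
  then show ?thesis using k g by simp
qed

end

text \<open>A section \<open>s\<close> over \<open>U\<close> together with the coordinate \<open>\<gamma>\<close> relative to it. Recording both lets
  all bundles associated with \<open>P\<close> be trivialized over one \<open>U\<close> by one \<open>s\<close>.\<close>

definition local_section ::
    "('g::topological_space) monoid \<Rightarrow> ('g, 'e, 'b) right_bundle \<Rightarrow> 'b set \<Rightarrow> ('b \<Rightarrow> 'e)
      \<Rightarrow> ('e \<Rightarrow> 'g) \<Rightarrow> bool" where
  "local_section G P U s \<gamma> \<longleftrightarrow>
     openin (bas P) U \<and>
     continuous_map (subtopology (bas P) U) (tot P) s \<and>
     (\<forall>x\<in>U. prj P (s x) = x) \<and>
     continuous_map (subtopology (tot P) {e \<in> topspace (tot P). prj P e \<in> U})
       (top_of_set (carrier G)) \<gamma> \<and>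
     (\<forall>e\<in>topspace (tot P). prj P e \<in> U \<longrightarrow> e = act P (s (prj P e)) (\<gamma> e))"

context principal
begin

text \<open>The section is the slice of a trivialization at the unit of \<open>G\<close>; equivariance then turns the
  trivialization into \<open>(x, g) \<mapsto> s x \<cdot> g\<close>.\<close>

lemma local_section_exists:
  assumes "b \<in> topspace (bas P)"
  obtains U s \<gamma> where "local_section G P U s \<gamma>" "b \<in> U"
proof -
  obtain U \<Psi> \<Phi> where U: "openin (bas P) U" "b \<in> U"
    and hom: "homeomorphic_maps (prod_topology (subtopology (bas P) U) (top_of_set (carrier G)))
       (subtopology (tot P) {e \<in> topspace (tot P). prj P e \<in> U}) \<Psi> \<Phi>"
    and pr: "\<And>x g. x \<in> U \<Longrightarrow> g \<in> carrier G \<Longrightarrow> prj P (\<Psi> (x, g)) = x"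
    and eq: "\<And>x g h. x \<in> U \<Longrightarrow> g \<in> carrier G \<Longrightarrow> h \<in> carrier G \<Longrightarrow>
       \<Psi> (x, g \<otimes> h) = act P (\<Psi> (x, g)) h"
    and coord: "\<And>e. e \<in> topspace (tot P) \<Longrightarrow> prj P e \<in> U \<Longrightarrow>
       snd (\<Phi> e) \<in> carrier G \<and> e = \<Psi> (prj P e, snd (\<Phi> e))"
    by (rule trivialization[OF assms]) blast
  let ?EU = "subtopology (tot P) {e \<in> topspace (tot P). prj P e \<in> U}"
  let ?UG = "prod_topology (subtopology (bas P) U) (top_of_set (carrier G))"
  have "continuous_map (subtopology (bas P) U) ?UG (\<lambda>x. (x, \<one>))"
    by (intro continuous_map_pairedI) auto
  moreover have "continuous_map ?UG (tot P) \<Psi>"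
    using hom unfolding homeomorphic_maps_def continuous_map_in_subtopology by blast
  ultimately have "continuous_map (subtopology (bas P) U) (tot P) (\<Psi> \<circ> (\<lambda>x. (x, \<one>)))"
    by (rule continuous_map_compose)
  then have s: "continuous_map (subtopology (bas P) U) (tot P) (\<lambda>x. \<Psi> (x, \<one>))"
    by (simp add: o_def)
  have "continuous_map ?EU ?UG \<Phi>" using hom unfolding homeomorphic_maps_def by blast
  then have \<gamma>: "continuous_map ?EU (top_of_set (carrier G)) (\<lambda>e. snd (\<Phi> e))"
    using continuous_map_compose[OF _ continuous_map_snd] by (simp add: o_def)
  have "e = act P (\<Psi> (prj P e, \<one>)) (snd (\<Phi> e))" if e: "e \<in> topspace (tot P)" "prj P e \<in> U" for e
    using coord[OF e] eq[OF e(2) one_closed, of "snd (\<Phi> e)"] by simp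
  then have "local_section G P U (\<lambda>x. \<Psi> (x, \<one>)) (\<lambda>e. snd (\<Phi> e))"
    unfolding local_section_def using U s \<gamma> pr by simp
  then show ?thesis using that U by blast
qed

lemma fibre_nonempty:
  assumes "b \<in> topspace (bas P)"
  obtains e where "e \<in> topspace (tot P)" "prj P e = b"
proof -
  obtain U s \<gamma> where s: "local_section G P U s \<gamma>" "b \<in> U" using local_section_exists[OF assms] .
  then have "s b \<in> topspace (tot P)" "prj P (s b) = b"
    using assms unfolding local_section_def continuous_map_def by auto
  then show ?thesis using that by blast
qed

end

section \<open>Associated bundles\<close>

locale associated_bundle = principal G P
  for G :: "('g::topological_space) monoid" (structure) and P :: "('g, 'e, 'b) right_bundle" +
  fixes F :: "'f topology" and a :: "'g \<Rightarrow> 'f \<Rightarrow> 'f"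
  assumes action_one: "y \<in> topspace F \<Longrightarrow> a \<one> y = y"
    and action_mult: "y \<in> topspace F \<Longrightarrow> g \<in> carrier G \<Longrightarrow> h \<in> carrier G \<Longrightarrow>
      a (g \<otimes> h) y = a g (a h y)"
    and action_continuous:
      "continuous_map (prod_topology (top_of_set (carrier G)) F) F (\<lambda>(g, y). a g y)"
begin

abbreviation cls :: "'e \<times> 'f \<Rightarrow> ('e \<times> 'f) set" where
  "cls \<equiv> assoc_class G P a"

abbreviation space :: "('e \<times> 'f) set topology" where
  "space \<equiv> assoc_space G P F a"

lemma action_in: "y \<in> topspace F \<Longrightarrow> g \<in> carrier G \<Longrightarrow> a g y \<in> topspace F"
  using continuous_map_image_subset_topspace[OF action_continuous] by (auto simp: image_subset_iff)

lemma action_inv_cancel: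
  "y \<in> topspace F \<Longrightarrow> g \<in> carrier G \<Longrightarrow> a (inv g) (a g y) = y"
  "y \<in> topspace F \<Longrightarrow> g \<in> carrier G \<Longrightarrow> a g (a (inv g) y) = y"
  using action_mult[of y "inv g" g] action_mult[of y g "inv g"] action_one by simp_all

lemma quotient_map_cls: "quotient_map (prod_topology (tot P) F) space cls"
  unfolding assoc_space_def by (rule quotient_map_quotient_topology)

lemma topspace_space: "topspace space = cls ` (topspace (tot P) \<times> topspace F)"
  by (simp add: assoc_space_def topspace_quotient_topology)

lemma cls_in: "e \<in> topspace (tot P) \<Longrightarrow> y \<in> topspace F \<Longrightarrow> cls (e, y) \<in> topspace space"
  by (simp add: topspace_space)

lemma mem_cls:
  "z \<in> cls (e, y) \<longleftrightarrow> (\<exists>g\<in>carrier G. z = (act P e g, a (inv g) y))"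
  by (auto simp: assoc_class_def)

lemma self_mem_cls: "e \<in> topspace (tot P) \<Longrightarrow> y \<in> topspace F \<Longrightarrow> (e, y) \<in> cls (e, y)"
  unfolding mem_cls by (rule bexI[of _ \<one>]) (simp_all add: act_one action_one)

lemma cls_act:
  assumes e: "e \<in> topspace (tot P)" and y: "y \<in> topspace F" and g: "g \<in> carrier G"
  shows "cls (act P e g, a (inv g) y) = cls (e, y)"
proof (intro equalityI subsetI)
  fix z assume "z \<in> cls (act P e g, a (inv g) y)"
  then obtain h where h: "h \<in> carrier G" "z = (act P (act P e g) h, a (inv h) (a (inv g) y))"
    unfolding mem_cls by blast
  then have "z = (act P e (g \<otimes> h), a (inv (g \<otimes> h)) y)"
    using assms by (simp add: act_mult inv_mult_group action_mult)
  then show "z \<in> cls (e, y)" unfolding mem_cls using g h by blast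
next
  fix z assume "z \<in> cls (e, y)"
  then obtain h where h: "h \<in> carrier G" "z = (act P e h, a (inv h) y)"
    unfolding mem_cls by blast
  have "g \<otimes> (inv g \<otimes> h) = h" using g h by (simp add: m_assoc[symmetric])
  then have "z = (act P (act P e g) (inv g \<otimes> h), a (inv (inv g \<otimes> h)) (a (inv g) y))"
    using assms h act_mult[of e g "inv g \<otimes> h"]
    by (simp add: inv_mult_group action_mult[symmetric] m_assoc)
  then show "z \<in> cls (act P e g, a (inv g) y)" unfolding mem_cls using g h by blast
qed

lemma assoc_prj_cls:
  assumes "e \<in> topspace (tot P)" "y \<in> topspace F"
  shows "assoc_prj P (cls (e, y)) = prj P e"
proof -
  have "(\<lambda>z. prj P (fst z)) ` cls (e, y) = {prj P e}"
    using self_mem_cls[OF assms] act_prj[OF assms(1)] by (force simp: mem_cls)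
  then show ?thesis by (simp add: assoc_prj_def)
qed

text \<open>Transitivity on the fibres allows the first component to be prescribed.\<close>

lemma representative:
  assumes "c \<in> topspace space" "e \<in> topspace (tot P)" "prj P e = assoc_prj P c"
  obtains y where "y \<in> topspace F" "c = cls (e, y)"
proof -
  obtain e0 y0 where c: "c = cls (e0, y0)" "e0 \<in> topspace (tot P)" "y0 \<in> topspace F"
    using assms(1) unfolding topspace_space by auto
  then have "prj P e0 = prj P e" using assms assoc_prj_cls by simp
  then obtain g where "g \<in> carrier G" "e = act P e0 g"
    using act_transitive c assms by metis
  then show ?thesis using that[of "a (inv g) y0"] c by (simp add: action_in cls_act)
qed

text \<open>Freeness of the action on \<open>P\<close> makes the representative with first component \<open>e\<close> unique.\<close>

lemma mem_cls_same:
  assumes "e \<in> topspace (tot P)" "y \<in> topspace F"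
  shows "(e, y') \<in> cls (e, y) \<longleftrightarrow> y' = y"
proof
  assume "(e, y') \<in> cls (e, y)"
  then obtain g where g: "g \<in> carrier G" "act P e g = e" "y' = a (inv g) y"
    unfolding mem_cls by auto
  then have "g = \<one>" using act_free assms by blast
  then show "y' = y" using g action_one assms by simp
qed (use self_mem_cls assms in simp)

lemma continuous_map_assoc_prj: "continuous_map space (bas P) (assoc_prj P)"
proof -
  have "continuous_map (prod_topology (tot P) F) (bas P) (\<lambda>z. prj P (fst z))"
    using continuous_map_compose[OF continuous_map_fst continuous_map_prj] by (simp add: o_def)
  then have "continuous_map (prod_topology (tot P) F) (bas P) (assoc_prj P \<circ> cls)"
    by (rule continuous_map_eq) (auto simp: assoc_prj_cls)
  then show ?thesis using continuous_compose_quotient_map[OF quotient_map_cls] by blast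
qed

text \<open>Over \<open>U\<close>, every class has a unique representative with first component on the section, namely
  \<open>[e, y] = [s (prj e), \<gamma>(e) y]\<close>. The right-hand side depends continuously on \<open>(e, y)\<close>, and
  the class map stays a quotient map over the open set \<open>U\<close>.\<close>

lemma fibre_coordinate:
  assumes "local_section G P U s \<gamma>"
  obtains \<eta> where
    "continuous_map (subtopology space {c \<in> topspace space. assoc_prj P c \<in> U}) F \<eta>"
    "\<And>c. c \<in> topspace space \<Longrightarrow> assoc_prj P c \<in> U \<Longrightarrow>
       \<eta> c \<in> topspace F \<and> c = cls (s (assoc_prj P c), \<eta> c)"
proof -
  define \<eta> :: "('e \<times> 'f) set \<Rightarrow> 'f" where "\<eta> c = (THE y. (s (assoc_prj P c), y) \<in> c)" for c
  have U: "openin (bas P) U" and Usub: "U \<subseteq> topspace (bas P)"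
    using assms openin_subset unfolding local_section_def by blast+
  have s: "s x \<in> topspace (tot P)" "prj P (s x) = x" if "x \<in> U" for x
    using assms that Usub unfolding local_section_def continuous_map_def by auto
  have \<gamma>: "\<gamma> e \<in> carrier G" "e = act P (s (prj P e)) (\<gamma> e)"
    if "e \<in> topspace (tot P)" "prj P e \<in> U" for e
    using assms that unfolding local_section_def continuous_map_def by auto
  have \<eta>_cls: "\<eta> (cls (e, y)) = a (\<gamma> e) y"
    if e: "e \<in> topspace (tot P)" "prj P e \<in> U" and y: "y \<in> topspace F" for e y
  proof -
    have "cls (e, y) = cls (act P (s (prj P e)) (\<gamma> e), a (inv (\<gamma> e)) (a (\<gamma> e) y))"
      using \<gamma>[OF e] y by (simp add: action_inv_cancel)
    also have "\<dots> = cls (s (prj P e), a (\<gamma> e) y)"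
      using \<gamma>[OF e] s[OF e(2)] y by (intro cls_act) (auto simp: action_in)
    finally have "cls (e, y) = cls (s (prj P e), a (\<gamma> e) y)" .
    then have "(s (assoc_prj P (cls (e, y))), z) \<in> cls (e, y) \<longleftrightarrow> z = a (\<gamma> e) y" for z
      using mem_cls_same[OF s(1)[OF e(2)] action_in[OF y \<gamma>(1)[OF e]]] assoc_prj_cls[OF e(1) y]
      by simp
    then show ?thesis by (simp add: \<eta>_def)
  qed
  let ?V = "{c \<in> topspace space. assoc_prj P c \<in> U}"
  let ?W = "{z \<in> topspace (prod_topology (tot P) F). cls z \<in> ?V}"
  have W: "?W = {e \<in> topspace (tot P). prj P e \<in> U} \<times> topspace F"
    by (auto simp: assoc_prj_cls cls_in)
  have "openin space ?V" using openin_continuous_map_preimage[OF continuous_map_assoc_prj U] .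
  then have q: "quotient_map (subtopology (prod_topology (tot P) F) ?W) (subtopology space ?V) cls"
    using quotient_map_restriction[OF quotient_map_cls] by blast
  have g: "continuous_map (subtopology (prod_topology (tot P) F) ?W) (top_of_set (carrier G))
      (\<lambda>z. \<gamma> (fst z))"
  proof -
    have "continuous_map (subtopology (prod_topology (tot P) F) ?W)
        (subtopology (tot P) {e \<in> topspace (tot P). prj P e \<in> U}) fst"
      unfolding W continuous_map_in_subtopology
      by (auto intro!: continuous_map_from_subtopology continuous_map_fst)
    moreover have "continuous_map (subtopology (tot P) {e \<in> topspace (tot P). prj P e \<in> U})
        (top_of_set (carrier G)) \<gamma>"
      using assms unfolding local_section_def by blast
    ultimately have "continuous_map (subtopology (prod_topology (tot P) F) ?W)
        (top_of_set (carrier G)) (\<gamma> \<circ> fst)"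
      by (rule continuous_map_compose)
    then show ?thesis by (simp only: o_def)
  qed
  have "continuous_map (subtopology (prod_topology (tot P) F) ?W) F
      ((\<lambda>(g, y). a g y) \<circ> (\<lambda>z. (\<gamma> (fst z), snd z)))"
    by (intro continuous_map_compose[OF _ action_continuous] continuous_map_pairedI g
        continuous_map_from_subtopology continuous_map_snd)
  then have "continuous_map (subtopology (prod_topology (tot P) F) ?W) F (\<eta> \<circ> cls)"
    by (rule continuous_map_eq) (auto simp: assoc_prj_cls \<eta>_cls)
  then have cont: "continuous_map (subtopology space ?V) F \<eta>"
    using continuous_compose_quotient_map[OF q] by blast
  have "\<eta> c \<in> topspace F \<and> c = cls (s (assoc_prj P c), \<eta> c)"
    if c: "c \<in> topspace space" "assoc_prj P c \<in> U" for c
  proof -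
    obtain y where y: "y \<in> topspace F" "c = cls (s (assoc_prj P c), y)"
      using representative[OF c(1) s[OF c(2)]] .
    then have "(s (assoc_prj P c), z) \<in> c \<longleftrightarrow> z = y" for z
      using mem_cls_same[OF s(1)[OF c(2)] y(1)] by metis
    then have "\<eta> c = y" by (simp add: \<eta>_def)
    then show ?thesis using y by simp
  qed
  then show ?thesis using that cont by blast
qed

end

section \<open>Homomorphisms of matrix algebras and the projective unitary group\<close>

lemma matrix_algebra_simps [simp]:
  "carrier matrix_algebra = UNIV" "mult matrix_algebra = (**)" "one matrix_algebra = mat 1"
  "add matrix_algebra = (+)" "smult matrix_algebra = cmat_scale"
  "star matrix_algebra = cmat_star"
  by (simp_all add: matrix_algebra_def)

lemma star_hom_matrix_algebra_iff:
  "h \<in> star_hom matrix_algebra matrix_algebra \<longleftrightarrow>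
     (\<forall>x y. h (x ** y) = h x ** h y) \<and> (\<forall>x y. h (x + y) = h x + h y) \<and> h (mat 1) = mat 1 \<and>
     (\<forall>z x. h (cmat_scale z x) = cmat_scale z (h x)) \<and> (\<forall>x. h (cmat_star x) = cmat_star (h x))"
  by (auto simp: star_hom_def ring_hom_def)

text \<open>Real scalars act as complex ones, and linear maps in finite dimensions are bounded; so every
  *-homomorphism is the underlying function of an element of \<open>Fr\<close>.\<close>

lemma star_hom_bounded_linear:
  fixes h :: "'k::finite cmat \<Rightarrow> 'n::finite cmat"
  assumes h: "h \<in> star_hom matrix_algebra matrix_algebra"
  shows "bounded_linear h"
proof -
  have scale: "r *\<^sub>R a = cmat_scale (of_real r) a" for r and a :: "'m::finite cmat"
    by (simp add: cmat_scale_def vec_eq_iff scaleR_conv_of_real[where 'a = complex])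
  have "linear h"
    by (rule linearI) (use h in \<open>auto simp: star_hom_matrix_algebra_iff scale\<close>)
  then show ?thesis by (simp add: linear_conv_bounded_linear)
qed

lemma Blinfun_in_Fr:
  assumes "h \<in> star_hom matrix_algebra matrix_algebra"
  shows "Blinfun h \<in> Fr" "blinfun_apply (Blinfun h) = h"
  using assms star_hom_bounded_linear[OF assms]
  by (simp_all add: Fr_def bounded_linear_Blinfun_apply)

lemma Fr_iff:
  "h \<in> Fr \<longleftrightarrow>
     (\<forall>x y. h (x ** y) = h x ** h y) \<and> (\<forall>x y. h (x + y) = h x + h y) \<and> h (mat 1) = mat 1 \<and>
     (\<forall>z x. h (cmat_scale z x) = cmat_scale z (h x)) \<and> (\<forall>x. h (cmat_star x) = cmat_star (h x))"
  by (simp add: Fr_def star_hom_matrix_algebra_iff)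

lemma Fr_compose: "g \<in> Fr \<Longrightarrow> h \<in> Fr \<Longrightarrow> h o\<^sub>L g \<in> Fr"
  by (simp add: Fr_iff)

lemma PU_simps [simp]:
  "carrier PU = {g \<in> Fr. bij (blinfun_apply g)}" "mult PU = (o\<^sub>L)" "one PU = id_blinfun"
  by (simp_all add: PU_def)

lemma group_PU: "group (PU :: ('k::finite cmat \<Rightarrow>\<^sub>L 'k cmat) monoid)"
proof (rule groupI)
  show "x \<otimes>\<^bsub>PU\<^esub> y \<in> carrier PU" if "x \<in> carrier PU" "y \<in> carrier PU" for x y :: "'k cmat \<Rightarrow>\<^sub>L 'k cmat"
  proof -
    have "blinfun_apply (x o\<^sub>L y) = blinfun_apply x \<circ> blinfun_apply y"
      by (simp add: fun_eq_iff)
    moreover have "bij (blinfun_apply x \<circ> blinfun_apply y)" using that by (intro bij_comp) auto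
    ultimately show ?thesis using that by (simp add: Fr_compose)
  qed
  show "\<one>\<^bsub>PU\<^esub> \<in> carrier (PU :: ('k cmat \<Rightarrow>\<^sub>L 'k cmat) monoid)"
  proof -
    have "blinfun_apply (id_blinfun :: 'k cmat \<Rightarrow>\<^sub>L 'k cmat) = id" by (simp add: fun_eq_iff)
    then show ?thesis by (simp add: Fr_iff)
  qed
  show "(x \<otimes>\<^bsub>PU\<^esub> y) \<otimes>\<^bsub>PU\<^esub> z = x \<otimes>\<^bsub>PU\<^esub> (y \<otimes>\<^bsub>PU\<^esub> z)" for x y z :: "'k cmat \<Rightarrow>\<^sub>L 'k cmat"
    by (auto intro: blinfun_eqI)
  show "\<one>\<^bsub>PU\<^esub> \<otimes>\<^bsub>PU\<^esub> x = x" for x :: "'k cmat \<Rightarrow>\<^sub>L 'k cmat"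
    by (auto intro: blinfun_eqI)
  show "\<exists>y\<in>carrier PU. y \<otimes>\<^bsub>PU\<^esub> x = \<one>\<^bsub>PU\<^esub>" if "x \<in> carrier PU" for x :: "'k cmat \<Rightarrow>\<^sub>L 'k cmat"
  proof -
    let ?i = "Hilbert_Choice.inv (blinfun_apply x)"
    have x: "x \<in> Fr" and b: "bij (blinfun_apply x)" using that by auto
    have i [simp]: "x (?i a) = a" "?i (x a) = a" for a
      using b by (simp_all add: bij_def surj_f_inv_f)
    have flip: "?i a = c" if "a = x c" for a c using that by simp
    have "?i \<in> star_hom matrix_algebra matrix_algebra"
      unfolding star_hom_matrix_algebra_iff
      by (intro conjI allI flip) (use x in \<open>simp_all add: Fr_iff\<close>)
    note B = Blinfun_in_Fr[OF this]
    have "Blinfun ?i \<in> carrier PU"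
      using B b by (simp add: bij_imp_bij_inv)
    moreover have "Blinfun ?i \<otimes>\<^bsub>PU\<^esub> x = \<one>\<^bsub>PU\<^esub>"
      using B by (auto intro: blinfun_eqI)
    ultimately show ?thesis by blast
  qed
qed

lemma PU_inv_apply:
  assumes "g \<in> carrier PU"
  shows "g ((inv\<^bsub>PU\<^esub> g) a) = a" "(inv\<^bsub>PU\<^esub> g) (g a) = a"
proof -
  have "g o\<^sub>L inv\<^bsub>PU\<^esub> g = id_blinfun" "inv\<^bsub>PU\<^esub> g o\<^sub>L g = id_blinfun"
    using group.r_inv[OF group_PU assms] group.l_inv[OF group_PU assms] by simp_all
  from this[THEN arg_cong[where f = "\<lambda>h. blinfun_apply h a"]]
  show "g ((inv\<^bsub>PU\<^esub> g) a) = a" "(inv\<^bsub>PU\<^esub> g) (g a) = a" by simp_all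
qed

text \<open>From \<open>h\<inverse> - g\<inverse> = g\<inverse> (g - h) h\<inverse>\<close> one first gets a bound on \<open>\<parallel>h\<inverse>\<parallel>\<close> for \<open>h\<close> close to \<open>g\<close>, and
  then, by the same identity, that \<open>h\<inverse>\<close> is close to \<open>g\<inverse>\<close>.\<close>

lemma continuous_on_PU_inv:
  "continuous_on (carrier PU) (\<lambda>g. inv\<^bsub>PU\<^esub> g :: 'k::finite cmat \<Rightarrow>\<^sub>L 'k cmat)"
proof (rule continuous_on_iff[THEN iffD2], intro ballI allI impI)
  fix g :: "'k cmat \<Rightarrow>\<^sub>L 'k cmat" and \<epsilon> :: real
  assume g: "g \<in> carrier PU" and \<epsilon>: "0 < \<epsilon>"
  define M where "M = norm (inv\<^bsub>PU\<^esub> g) + 1"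
  have M: "M > 0" "norm (inv\<^bsub>PU\<^esub> g) \<le> M" unfolding M_def by (simp_all add: add_nonneg_pos)
  \<comment> \<open>The first bound makes \<open>\<parallel>h\<inverse>\<parallel> \<le> 2 M\<close>, the second then makes the distance less than \<open>\<epsilon>\<close>.\<close>
  define \<delta> where "\<delta> = min (1 / (2 * M)) (\<epsilon> / (2 * M\<^sup>2))"
  have \<delta>: "\<delta> > 0" using M \<epsilon> by (simp add: \<delta>_def)
  have "dist (inv\<^bsub>PU\<^esub> h) (inv\<^bsub>PU\<^esub> g) < \<epsilon>" if h: "h \<in> carrier PU" and hg: "dist h g < \<delta>" for h
  proof -
    let ?n = "norm (inv\<^bsub>PU\<^esub> h)" and ?d = "norm (g - h)"
    have d: "?d < \<delta>" using hg by (simp add: dist_norm norm_minus_commute)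
    have "inv\<^bsub>PU\<^esub> h - inv\<^bsub>PU\<^esub> g = (inv\<^bsub>PU\<^esub> g o\<^sub>L (g - h)) o\<^sub>L inv\<^bsub>PU\<^esub> h"
      by (rule blinfun_eqI)
        (simp add: blinfun.diff_left blinfun.diff_right PU_inv_apply[OF g] PU_inv_apply[OF h])
    then have "norm (inv\<^bsub>PU\<^esub> h - inv\<^bsub>PU\<^esub> g) \<le> norm (inv\<^bsub>PU\<^esub> g o\<^sub>L (g - h)) * ?n"
      by (simp only: norm_blinfun_compose)
    also have "\<dots> \<le> norm (inv\<^bsub>PU\<^esub> g) * ?d * ?n"
      by (intro mult_right_mono norm_blinfun_compose) auto
    also have "\<dots> \<le> M * ?d * ?n"
      using M by (intro mult_right_mono) auto
    finally have diff: "norm (inv\<^bsub>PU\<^esub> h - inv\<^bsub>PU\<^esub> g) \<le> M * ?d * ?n" .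
    have "M * ?d \<le> M * (1 / (2 * M))"
      using d M by (intro mult_left_mono) (auto simp: \<delta>_def)
    then have "M * ?d \<le> 1 / 2" using M by simp
    then have "M * ?d * ?n \<le> 1 / 2 * ?n" by (intro mult_right_mono) auto
    moreover have "?n \<le> norm (inv\<^bsub>PU\<^esub> g) + norm (inv\<^bsub>PU\<^esub> h - inv\<^bsub>PU\<^esub> g)"
      by (metis norm_triangle_sub)
    ultimately have n: "?n \<le> 2 * M" using diff M by linarith
    have "M * ?d * ?n \<le> M * ?d * (2 * M)" using n M by (intro mult_left_mono) auto
    also have "\<dots> < M * (\<epsilon> / (2 * M\<^sup>2)) * (2 * M)"
      using d M by (intro mult_strict_right_mono mult_strict_left_mono) (auto simp: \<delta>_def)
    also have "\<dots> = \<epsilon>" using M by (simp add: power2_eq_square)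
    finally show ?thesis using diff by (simp add: dist_norm)
  qed
  then show "\<exists>\<delta>>0. \<forall>h\<in>carrier PU. dist h g < \<delta> \<longrightarrow> dist (inv\<^bsub>PU\<^esub> h) (inv\<^bsub>PU\<^esub> g) < \<epsilon>"
    using \<delta> by blast
qed

section \<open>The bundles of algebras and of homomorphisms\<close>

lemma continuous_map_blinfun_apply:
  assumes "continuous_map X euclidean h" "continuous_map X euclidean v"
  shows "continuous_map X euclidean (\<lambda>x. blinfun_apply (h x) (v x))"
  using assms by (auto simp: continuous_map_atin intro!: blinfun.tendsto)

lemma continuous_map_blinfun_componentwise:
  fixes h :: "'x \<Rightarrow> 'a::euclidean_space \<Rightarrow>\<^sub>L 'b::real_normed_vector"
  assumes "\<And>v. continuous_map X euclidean (\<lambda>x. blinfun_apply (h x) v)"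
  shows "continuous_map X euclidean h"
  using assms by (auto simp: continuous_map_atin intro!: tendsto_componentwise1)

lemma continuous_map_locally:
  assumes "\<And>x. x \<in> topspace X \<Longrightarrow>
    \<exists>W. openin X W \<and> x \<in> W \<and> continuous_map (subtopology X W) Y f"
  shows "continuous_map X Y f"
proof -
  obtain W where "\<And>x. x \<in> topspace X \<Longrightarrow>
      openin X (W x) \<and> x \<in> W x \<and> continuous_map (subtopology X (W x)) Y f"
    using assms by metis
  then show ?thesis
    by (intro pasting_lemma[of "topspace X" X W Y "\<lambda>_. f"]) auto
qed

lemma associated_bundle_algebra:
  fixes P :: "('k::finite, 'e, 'b) PU_bundle"
  assumes "principal_bundle PU P"
  shows "associated_bundle PU P euclidean blinfun_apply"
proof -
  interpret principal PU P
    by (intro principal.intro group_PU principal_axioms.intro assms)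
  have "continuous_map (prod_topology (top_of_set (carrier PU)) euclidean) euclidean
      (\<lambda>z. blinfun_apply (fst z :: 'k cmat \<Rightarrow>\<^sub>L 'k cmat) (snd z))"
    by (intro continuous_map_blinfun_apply continuous_map_into_fulltopology[OF continuous_map_fst]
        continuous_map_snd)
  then show ?thesis
    by unfold_locales (simp_all add: case_prod_beta')
qed

text \<open>Continuity of \<open>(g, h) \<mapsto> h \<circ> g\<inverse>\<close> rests on that of inversion in \<open>PU\<close>.\<close>

lemma associated_bundle_homomorphisms:
  fixes P :: "('k::finite, 'e, 'b) PU_bundle"
  assumes "principal_bundle PU P"
  shows "associated_bundle PU P (top_of_set (Fr :: ('k cmat \<Rightarrow>\<^sub>L 'n::finite cmat) set))
    (\<lambda>g h. h o\<^sub>L inv\<^bsub>PU\<^esub> g)"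
proof -
  interpret principal PU P
    by (intro principal.intro group_PU principal_axioms.intro assms)
  let ?T = "prod_topology (top_of_set (carrier (PU :: ('k cmat \<Rightarrow>\<^sub>L 'k cmat) monoid)))
    (top_of_set (Fr :: ('k cmat \<Rightarrow>\<^sub>L 'n cmat) set))"
  have inv_Fr: "inv\<^bsub>PU\<^esub> g \<in> Fr" if "g \<in> carrier PU" for g :: "'k cmat \<Rightarrow>\<^sub>L 'k cmat"
    using inv_closed[OF that] by simp
  have "continuous_map (top_of_set (carrier PU)) euclidean
      (\<lambda>g. inv\<^bsub>PU\<^esub> g :: 'k cmat \<Rightarrow>\<^sub>L 'k cmat)"
    using continuous_on_PU_inv by simp
  then have "continuous_map ?T euclidean ((\<lambda>g. inv\<^bsub>PU\<^esub> g) \<circ> fst)"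
    by (rule continuous_map_compose[OF continuous_map_fst])
  then have "continuous_map ?T euclidean (\<lambda>z. inv\<^bsub>PU\<^esub> (fst z))"
    by (simp only: o_def)
  moreover have "continuous_map ?T euclidean snd"
    by (rule continuous_map_into_fulltopology[OF continuous_map_snd])
  ultimately have "continuous_map ?T euclidean (\<lambda>z. snd z o\<^sub>L inv\<^bsub>PU\<^esub> (fst z))"
    by (auto simp: continuous_map_atin intro!: bounded_bilinear.tendsto[OF bounded_bilinear_blinfun_compose])
  then have cont: "continuous_map ?T (top_of_set Fr) (\<lambda>(g, h). h o\<^sub>L inv\<^bsub>PU\<^esub> g)"
    unfolding case_prod_beta'
    by (rule continuous_map_into_subtopology) (auto intro!: Fr_compose inv_Fr)
  show ?thesis
  proof
    fix h :: "'k cmat \<Rightarrow>\<^sub>L 'n cmat"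
    have "h o\<^sub>L inv\<^bsub>PU\<^esub> \<one>\<^bsub>PU\<^esub> = h o\<^sub>L id_blinfun" by (simp only: inv_one) simp
    also have "\<dots> = h" by (rule blinfun_eqI) simp
    finally show "h o\<^sub>L inv\<^bsub>PU\<^esub> \<one>\<^bsub>PU\<^esub> = h" .
    fix g g' :: "'k cmat \<Rightarrow>\<^sub>L 'k cmat" assume "g \<in> carrier PU" "g' \<in> carrier PU"
    from inv_mult_group[OF this]
    show "h o\<^sub>L inv\<^bsub>PU\<^esub> (g \<otimes>\<^bsub>PU\<^esub> g') = (h o\<^sub>L inv\<^bsub>PU\<^esub> g') o\<^sub>L inv\<^bsub>PU\<^esub> g"
      by (auto intro: blinfun_eqI)
  qed (rule cont)
qed

abbreviation A_class ::
    "('k::finite, 'e, 'b) PU_bundle \<Rightarrow> 'e \<Rightarrow> 'k cmat \<Rightarrow> ('e \<times> 'k cmat) set" where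
  "A_class P e a \<equiv> assoc_class PU P blinfun_apply (e, a)"

abbreviation H_class ::
    "('k::finite, 'e, 'b) PU_bundle \<Rightarrow> 'e \<Rightarrow> ('k cmat \<Rightarrow>\<^sub>L 'n::finite cmat)
      \<Rightarrow> ('e \<times> ('k cmat \<Rightarrow>\<^sub>L 'n cmat)) set" where
  "H_class P e h \<equiv> assoc_class PU P (\<lambda>g h. h o\<^sub>L inv\<^bsub>PU\<^esub> g) (e, h)"

locale PU_principal =
  fixes P :: "('k::finite, 'e, 'b) PU_bundle"
  assumes principal_PU: "principal_bundle PU P"

sublocale PU_principal \<subseteq> A: associated_bundle PU P euclidean blinfun_apply
  by (rule associated_bundle_algebra[OF principal_PU])

context PU_principal
begin

lemma A_space: "assoc_space PU P euclidean blinfun_apply = A_univ P"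
  by (simp add: A_univ_def)

text \<open>Over \<open>e \<cdot> g\<close> the two representatives are \<open>h \<circ> g\<close> and \<open>g\<inverse> a\<close>, so that their evaluation does
  not depend on \<open>g\<close>.\<close>

lemma H_eval_class:
  fixes h :: "'k cmat \<Rightarrow>\<^sub>L 'n::finite cmat"
  assumes e: "e \<in> topspace (tot P)" and h: "h \<in> Fr"
  shows "H_eval (H_class P e h) (A_class P e a) = h a"
proof -
  interpret H: associated_bundle PU P "top_of_set (Fr :: ('k cmat \<Rightarrow>\<^sub>L 'n cmat) set)"
    "\<lambda>g h. h o\<^sub>L inv\<^bsub>PU\<^esub> g"
    by (rule associated_bundle_homomorphisms[OF principal_PU])
  have "h' a' = h a" if u: "(e', h') \<in> H_class P e h" and c: "(e', a') \<in> A_class P e a" for e' h' a'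
  proof -
    obtain g where g: "g \<in> carrier PU" "e' = act P e g" "h' = h o\<^sub>L inv\<^bsub>PU\<^esub> (inv\<^bsub>PU\<^esub> g)"
      using u unfolding H.mem_cls by blast
    have "A_class P e' ((inv\<^bsub>PU\<^esub> g) a) = A_class P e a"
      unfolding g(2) using A.cls_act[OF e _ g(1), of a] by simp
    then have "a' = (inv\<^bsub>PU\<^esub> g) a"
      using c A.mem_cls_same[of e' "(inv\<^bsub>PU\<^esub> g) a" a'] A.act_in[OF e g(1)] g(2) by simp
    moreover have "inv\<^bsub>PU\<^esub> (inv\<^bsub>PU\<^esub> g) = g" by (rule A.inv_inv[OF g(1)])
    ultimately show ?thesis using g(3) PU_inv_apply(1)[OF g(1)] by simp
  qed
  moreover have "(e, h) \<in> H_class P e h" "(e, a) \<in> A_class P e a"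
    using H.self_mem_cls[OF e] A.self_mem_cls[OF e] h by simp_all
  ultimately have "{blinfun_apply h' a' |e' h' a'. (e', h') \<in> H_class P e h \<and> (e', a') \<in> A_class P e a}
      = {h a}"
    by blast
  then show ?thesis by (simp add: H_eval_def)
qed

lemma A_class_map:
  assumes "\<And>g x. g \<in> carrier PU \<Longrightarrow> g (\<phi> x) = \<phi> (blinfun_apply g x)"
  shows "{(e', \<phi> x) |e' x. (e', x) \<in> A_class P e a} = A_class P e (\<phi> a)"
  using assms[OF A.inv_closed] by (force simp only: A.mem_cls)

text \<open>As \<open>PU\<close> acts freely on \<open>P\<close>, members of two classes with equal first component come from the same
  \<open>g\<close>, which can then be moved out of \<open>\<phi>\<close>.\<close>

lemma A_class_map2:
  assumes e: "e \<in> topspace (tot P)"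
    and \<phi>: "\<And>g x y. g \<in> carrier PU \<Longrightarrow> g (\<phi> x y) = \<phi> (blinfun_apply g x) (blinfun_apply g y)"
  shows "{(e', \<phi> x y) |e' x y. (e', x) \<in> A_class P e a \<and> (e', y) \<in> A_class P e b}
    = A_class P e (\<phi> a b)"
proof -
  have act: "(act P e g, x) \<in> A_class P e a \<longleftrightarrow> x = (inv\<^bsub>PU\<^esub> g) a"
    if "g \<in> carrier PU" for g x a
    using A.mem_cls_same[of "act P e g" "(inv\<^bsub>PU\<^esub> g) a" x] A.act_in[OF e that]
      A.cls_act[OF e _ that, of a] by simp
  show ?thesis
  proof (intro equalityI subsetI)
    fix z assume "z \<in> {(e', \<phi> x y) |e' x y. (e', x) \<in> A_class P e a \<and> (e', y) \<in> A_class P e b}"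
    then obtain e' x y where z: "z = (e', \<phi> x y)" "(e', x) \<in> A_class P e a" "(e', y) \<in> A_class P e b"
      by blast
    then obtain g where g: "g \<in> carrier PU" "e' = act P e g" unfolding A.mem_cls by blast
    then show "z \<in> A_class P e (\<phi> a b)"
      using z act[OF g(1)] \<phi>[OF A.inv_closed[OF g(1)]] by simp
  next
    fix z assume "z \<in> A_class P e (\<phi> a b)"
    then obtain g where g: "g \<in> carrier PU" "z = (act P e g, (inv\<^bsub>PU\<^esub> g) (\<phi> a b))"
      unfolding A.mem_cls by blast
    then show "z \<in> {(e', \<phi> x y) |e' x y. (e', x) \<in> A_class P e a \<and> (e', y) \<in> A_class P e b}"
      using act[OF g(1)] \<phi>[OF A.inv_closed[OF g(1)]] by auto
  qed
qed

lemma A_class_fixed: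
  assumes e: "e \<in> topspace (tot P)" and z: "\<And>g. g \<in> carrier PU \<Longrightarrow> blinfun_apply g z = z"
  shows "{(e', z) |e'. e' \<in> topspace (tot P) \<and> prj P e' = prj P e} = A_class P e z"
proof (intro equalityI subsetI)
  fix w assume "w \<in> {(e', z) |e'. e' \<in> topspace (tot P) \<and> prj P e' = prj P e}"
  then obtain e' where w: "w = (e', z)" "e' \<in> topspace (tot P)" "prj P e = prj P e'" by auto
  obtain g where "g \<in> carrier PU" "e' = act P e g" using A.act_transitive[OF e w(2,3)] .
  then show "w \<in> A_class P e z" using w z[OF A.inv_closed] unfolding A.mem_cls by auto
next
  fix w assume "w \<in> A_class P e z"
  then obtain g where g: "g \<in> carrier PU" "w = (act P e g, (inv\<^bsub>PU\<^esub> g) z)"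
    unfolding A.mem_cls by blast
  then show "w \<in> {(e', z) |e'. e' \<in> topspace (tot P) \<and> prj P e' = prj P e}"
    using z[OF A.inv_closed] A.act_in[OF e] A.act_prj[OF e] by simp
qed

lemma A_fibre_carrier:
  assumes "e \<in> topspace (tot P)"
  shows "carrier (A_fibre P (prj P e)) = range (A_class P e)"
proof (intro equalityI subsetI)
  fix c assume "c \<in> carrier (A_fibre P (prj P e))"
  then have "c \<in> topspace (A_univ P)" "prj P e = assoc_prj P c" by (simp_all add: A_fibre_def)
  then obtain a where "c = A_class P e a"
    using A.representative[OF _ assms, of c] unfolding A_space by blast
  then show "c \<in> range (A_class P e)" by blast
next
  fix c assume "c \<in> range (A_class P e)"
  then show "c \<in> carrier (A_fibre P (prj P e))"
    using A.cls_in[OF assms] A.assoc_prj_cls[OF assms] by (auto simp: A_fibre_def A_space)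
qed

text \<open>The choice of a point \<open>e\<close> over \<open>b\<close> identifies the fibre over \<open>b\<close> with the matrix algebra,
  because elements of \<open>PU\<close> commute with all operations.\<close>

lemma star_hom_A_fibre_iff:
  assumes e: "e \<in> topspace (tot P)"
  shows "\<phi> \<in> star_hom (A_fibre P (prj P e)) matrix_algebra \<longleftrightarrow>
    (\<lambda>a. \<phi> (A_class P e a)) \<in> star_hom matrix_algebra matrix_algebra"
proof -
  let ?B = "A_fibre P (prj P e)"
  have PU: "g (x ** y) = g x ** g y" "g (x + y) = g x + g y" "g (mat 1) = mat 1"
    "g (cmat_scale z x) = cmat_scale z (g x)" "g (cmat_star x) = cmat_star (g x)"
    if "g \<in> carrier PU" for g :: "'k cmat \<Rightarrow>\<^sub>L 'k cmat" and x y z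
    using that by (simp_all add: Fr_iff)
  have ops: "A_class P e x \<otimes>\<^bsub>?B\<^esub> A_class P e y = A_class P e (x ** y)"
    "A_class P e x \<oplus>\<^bsub>?B\<^esub> A_class P e y = A_class P e (x + y)"
    "\<one>\<^bsub>?B\<^esub> = A_class P e (mat 1)"
    "z \<odot>\<^bsub>?B\<^esub> A_class P e x = A_class P e (cmat_scale z x)"
    "star ?B (A_class P e x) = A_class P e (cmat_star x)" for x y z
    using A_class_map2[OF e, of "(**)"] A_class_map2[OF e, of "(+)"] A_class_fixed[OF e, of "mat 1"]
      A_class_map[of "cmat_scale z"] A_class_map[of cmat_star] PU
    by (simp_all add: A_fibre_def del: PU_simps)
  have "(\<forall>x y. x \<in> range (A_class P e) \<and> y \<in> range (A_class P e) \<longrightarrow> Q x y) \<longleftrightarrow>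
      (\<forall>a b. Q (A_class P e a) (A_class P e b))" for Q
    by blast
  then show ?thesis
    unfolding star_hom_matrix_algebra_iff
    by (auto simp: star_hom_def ring_hom_def A_fibre_carrier[OF e] ops)
qed

end

section \<open>Lifts and embeddings\<close>

lemma topspace_A_pullback:
  "z \<in> topspace (A_pullback P X f) \<longleftrightarrow>
     fst z \<in> topspace X \<and> snd z \<in> topspace (A_univ P) \<and> f (fst z) = assoc_prj P (snd z)"
  by (cases z) (auto simp: A_pullback_def)

lemma continuous_map_A_pullback_fst: "continuous_map (A_pullback P X f) X fst"
  and continuous_map_A_pullback_snd: "continuous_map (A_pullback P X f) (A_univ P) snd"
  unfolding A_pullback_def
  by (auto intro: continuous_map_from_subtopology continuous_map_fst continuous_map_snd)

text \<open>The inverse correspondence. The representative of the class over \<open>x\<close> with first component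
  \<open>e\<close> is \<open>\<mu>\<close> over \<open>x\<close>, read in the coordinate \<open>a \<mapsto> [e, a]\<close> of the fibre; listing the
  representatives for all \<open>e\<close> avoids a choice.\<close>

definition lift_of_embedding ::
    "('k::finite, 'e, 'b) PU_bundle \<Rightarrow> 'x topology \<Rightarrow> ('x \<Rightarrow> 'b)
      \<Rightarrow> ('x \<times> ('e \<times> 'k cmat) set \<Rightarrow> 'x \<times> 'n::finite cmat)
      \<Rightarrow> 'x \<Rightarrow> ('e \<times> ('k cmat \<Rightarrow>\<^sub>L 'n cmat)) set" where
  "lift_of_embedding P X f \<mu> =
     restrict (\<lambda>x. {(e, Blinfun (\<lambda>a. snd (\<mu> (x, A_class P e a)))) |e.
       e \<in> topspace (tot P) \<and> prj P e = f x}) (topspace X)"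

locale PU_principal_map = PU_principal P
  for P :: "('k::finite, 'e, 'b) PU_bundle" +
  fixes X :: "'x topology" and f :: "'x \<Rightarrow> 'b"
  assumes f: "continuous_map X (bas P) f"
begin

lemma f_in: "x \<in> topspace X \<Longrightarrow> f x \<in> topspace (bas P)"
  using continuous_map_image_subset_topspace[OF f] by blast

lemma point_over:
  assumes "x \<in> topspace X"
  obtains e where "e \<in> topspace (tot P)" "prj P e = f x"
  using A.fibre_nonempty[OF f_in[OF assms]] .

lemma A_class_pullback:
  assumes "x \<in> topspace X" "e \<in> topspace (tot P)" "prj P e = f x"
  shows "(x, A_class P e a) \<in> topspace (A_pullback P X f)"
  using assms A.cls_in[of e a] A.assoc_prj_cls[of e a] by (simp add: topspace_A_pullback A_space)

lemma pullback_cases: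
  assumes "z \<in> topspace (A_pullback P X f)"
  obtains x e a where "x \<in> topspace X" "e \<in> topspace (tot P)" "prj P e = f x"
    "z = (x, A_class P e a)"
proof -
  have z: "fst z \<in> topspace X" "snd z \<in> topspace (A_univ P)" "f (fst z) = assoc_prj P (snd z)"
    using assms by (simp_all add: topspace_A_pullback)
  obtain e where e: "e \<in> topspace (tot P)" "prj P e = f (fst z)" using point_over[OF z(1)] .
  then obtain a where "snd z = A_class P e a"
    using A.representative[of "snd z" e] z by (auto simp: A_space)
  then show ?thesis using that[of "fst z" e a] z e by (simp add: prod_eq_iff)
qed

lemma lift_class:
  fixes F :: "'x \<Rightarrow> ('e \<times> ('k cmat \<Rightarrow>\<^sub>L 'n::finite cmat)) set"
  assumes F: "F \<in> lifts P X f" and x: "x \<in> topspace X"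
    and e: "e \<in> topspace (tot P)" "prj P e = f x"
  obtains h where "h \<in> Fr" "F x = H_class P e h"
proof -
  interpret H: associated_bundle PU P "top_of_set (Fr :: ('k cmat \<Rightarrow>\<^sub>L 'n cmat) set)"
    "\<lambda>g h. h o\<^sub>L inv\<^bsub>PU\<^esub> g"
    by (rule associated_bundle_homomorphisms[OF principal_PU])
  have "continuous_map X (H_univ P) F" "assoc_prj P (F x) = f x"
    using F x by (simp_all add: lifts_def)
  then have "F x \<in> topspace H.space"
    using x continuous_map_image_subset_topspace unfolding H_univ_def by blast
  moreover have "prj P e = assoc_prj P (F x)"
    using e \<open>assoc_prj P (F x) = f x\<close> by simp
  ultimately show ?thesis using H.representative[of "F x" e] e that by auto
qed

lemma embedding_of_lift_class:
  fixes F :: "'x \<Rightarrow> ('e \<times> ('k cmat \<Rightarrow>\<^sub>L 'n::finite cmat)) set"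
  assumes "x \<in> topspace X" "e \<in> topspace (tot P)" "prj P e = f x" "h \<in> Fr" "F x = H_class P e h"
  shows "embedding_of_lift P X f F (x, A_class P e a) = (x, h a)"
  using assms A_class_pullback H_eval_class by (simp add: embedding_of_lift_def)

text \<open>Over an open set \<open>U\<close> with a section of \<open>P\<close>, both the value of \<open>F\<close> and the argument \<open>c\<close> have
  continuous coordinates with respect to the same point of \<open>P\<close>, and the embedding is the
  evaluation of one at the other.\<close>

lemma continuous_map_H_eval:
  fixes F :: "'x \<Rightarrow> ('e \<times> ('k cmat \<Rightarrow>\<^sub>L 'n::finite cmat)) set"
  assumes F: "F \<in> lifts P X f"
  shows "continuous_map (A_pullback P X f) euclidean (\<lambda>z. H_eval (F (fst z)) (snd z))"
proof (rule continuous_map_locally)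
  interpret H: associated_bundle PU P "top_of_set (Fr :: ('k cmat \<Rightarrow>\<^sub>L 'n cmat) set)"
    "\<lambda>g h. h o\<^sub>L inv\<^bsub>PU\<^esub> g"
    by (rule associated_bundle_homomorphisms[OF principal_PU])
  have Fcont: "continuous_map X H.space F" and Fprj: "\<And>x. x \<in> topspace X \<Longrightarrow> assoc_prj P (F x) = f x"
    using F by (simp_all add: lifts_def H_univ_def)
  have F_in: "F x \<in> topspace H.space" if "x \<in> topspace X" for x
    using Fcont that continuous_map_image_subset_topspace by blast
  let ?A = "A_pullback P X f"
  fix z0 assume z0: "z0 \<in> topspace ?A"
  then have "fst z0 \<in> topspace X" by (simp add: topspace_A_pullback)
  from f_in[OF this] obtain U s \<gamma> where s: "local_section PU P U s \<gamma>" and U: "f (fst z0) \<in> U"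
    using A.local_section_exists by blast
  obtain \<eta> where \<eta>: "continuous_map
      (subtopology H.space {c \<in> topspace H.space. assoc_prj P c \<in> U}) (top_of_set Fr) \<eta>"
    and \<eta>_eq: "\<And>c. c \<in> topspace H.space \<Longrightarrow> assoc_prj P c \<in> U \<Longrightarrow>
      \<eta> c \<in> topspace (top_of_set Fr) \<and> c = H_class P (s (assoc_prj P c)) (\<eta> c)"
    by (rule H.fibre_coordinate[OF s]) blast
  obtain \<alpha> where \<alpha>: "continuous_map
      (subtopology A.space {c \<in> topspace A.space. assoc_prj P c \<in> U}) euclidean \<alpha>"
    and \<alpha>_eq: "\<And>c. c \<in> topspace A.space \<Longrightarrow> assoc_prj P c \<in> U \<Longrightarrow>
      \<alpha> c \<in> topspace euclidean \<and> c = A_class P (s (assoc_prj P c)) (\<alpha> c)"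
    by (rule A.fibre_coordinate[OF s]) blast
  define W where "W = {z \<in> topspace ?A. f (fst z) \<in> U}"
  have "openin X {x \<in> topspace X. f x \<in> U}"
    using openin_continuous_map_preimage[OF f] s unfolding local_section_def by blast
  from openin_continuous_map_preimage[OF continuous_map_A_pullback_fst this]
  have "openin ?A {z \<in> topspace ?A. fst z \<in> {x \<in> topspace X. f x \<in> U}}" .
  also have "{z \<in> topspace ?A. fst z \<in> {x \<in> topspace X. f x \<in> U}} = W"
    by (auto simp: W_def topspace_A_pullback)
  finally have W: "openin ?A W" .
  let ?W = "subtopology ?A W"
  have in_W: "fst z \<in> topspace X" "snd z \<in> topspace A.space" "assoc_prj P (snd z) = f (fst z)" "f (fst z) \<in> U"
    if "z \<in> topspace ?W" for z
    using that by (auto simp: W_def topspace_A_pullback A_space)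
  have "continuous_map ?W H.space (F \<circ> fst)"
    by (intro continuous_map_compose[OF _ Fcont] continuous_map_from_subtopology
        continuous_map_A_pullback_fst)
  then have "continuous_map ?W (subtopology H.space {c \<in> topspace H.space. assoc_prj P c \<in> U}) (F \<circ> fst)"
    by (rule continuous_map_into_subtopology) (use in_W Fprj F_in in auto)
  from continuous_map_into_fulltopology[OF continuous_map_compose[OF this \<eta>]]
  have 1: "continuous_map ?W euclidean (\<lambda>z. \<eta> (F (fst z)))" by (simp add: o_def)
  have "continuous_map ?W A.space snd"
    unfolding A_space
    by (intro continuous_map_from_subtopology continuous_map_A_pullback_snd)
  then have "continuous_map ?W (subtopology A.space {c \<in> topspace A.space. assoc_prj P c \<in> U}) snd"
    by (rule continuous_map_into_subtopology) (use in_W in auto)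
  from continuous_map_compose[OF this \<alpha>]
  have 2: "continuous_map ?W euclidean (\<lambda>z. \<alpha> (snd z))" by (simp add: o_def)
  have "blinfun_apply (\<eta> (F (fst z))) (\<alpha> (snd z)) = H_eval (F (fst z)) (snd z)" if z: "z \<in> topspace ?W" for z
  proof -
    note z = in_W[OF z]
    have "F (fst z) = H_class P (s (f (fst z))) (\<eta> (F (fst z)))" "\<eta> (F (fst z)) \<in> Fr"
      using \<eta>_eq[OF F_in[OF z(1)]] Fprj[OF z(1)] z(4) by auto
    moreover have "snd z = A_class P (s (f (fst z))) (\<alpha> (snd z))"
      using \<alpha>_eq[OF z(2)] z by auto
    moreover have "s (f (fst z)) \<in> topspace (tot P)"
      using s z f_in[OF z(1)] unfolding local_section_def continuous_map_def by auto
    ultimately show ?thesis using H_eval_class by metis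
  qed
  with continuous_map_blinfun_apply[OF 1 2]
  have "continuous_map ?W euclidean (\<lambda>z. H_eval (F (fst z)) (snd z))"
    by (rule continuous_map_eq)
  then show "\<exists>W. openin ?A W \<and> z0 \<in> W \<and>
      continuous_map (subtopology ?A W) euclidean (\<lambda>z. H_eval (F (fst z)) (snd z))"
    using W z0 U unfolding W_def by blast
qed

lemma embedding_of_lift_in:
  fixes F :: "'x \<Rightarrow> ('e \<times> ('k cmat \<Rightarrow>\<^sub>L 'n::finite cmat)) set"
  assumes F: "F \<in> lifts P X f"
  shows "embedding_of_lift P X f F \<in> fibrewise_embeddings P X f"
proof -
  let ?\<mu> = "embedding_of_lift P X f F"
  have "continuous_map (A_pullback P X f) (prod_topology X euclidean)
      (\<lambda>z. (fst z, H_eval (F (fst z)) (snd z)))"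
    by (intro continuous_map_pairedI continuous_map_A_pullback_fst continuous_map_H_eval[OF F])
  then have "continuous_map (A_pullback P X f) (prod_topology X euclidean) ?\<mu>"
    by (rule continuous_map_eq) (simp add: embedding_of_lift_def case_prod_beta)
  moreover have "(\<lambda>c. snd (?\<mu> (x, c))) \<in> star_hom (A_fibre P (f x)) matrix_algebra"
    if x: "x \<in> topspace X" for x
  proof -
    obtain e where e: "e \<in> topspace (tot P)" "prj P e = f x" using point_over[OF x] .
    obtain h where h: "h \<in> Fr" "F x = H_class P e h" using lift_class[OF F x e] .
    have "(\<lambda>a. snd (?\<mu> (x, A_class P e a))) = blinfun_apply h"
      using embedding_of_lift_class[OF x e h(1), of F] h(2) by auto
    then have "(\<lambda>a. snd (?\<mu> (x, A_class P e a))) \<in> star_hom matrix_algebra matrix_algebra"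
      using h(1) by (simp add: Fr_def)
    then show ?thesis
      using star_hom_A_fibre_iff[OF e(1), of "\<lambda>c. snd (?\<mu> (x, c))"] e(2) by simp
  qed
  moreover have "fst (?\<mu> z) = fst z" if "z \<in> topspace (A_pullback P X f)" for z
    using that by (simp add: embedding_of_lift_def case_prod_beta)
  ultimately show ?thesis
    unfolding fibrewise_embeddings_def by (simp add: embedding_of_lift_def)
qed

text \<open>Evaluation at all \<open>[e, a]\<close> with one fixed \<open>e\<close> determines \<open>h\<close>, hence the class \<open>[e, h]\<close>.\<close>

lemma embedding_of_lift_inj:
  "inj_on (embedding_of_lift P X f)
     (lifts P X f :: ('x \<Rightarrow> ('e \<times> ('k cmat \<Rightarrow>\<^sub>L 'n::finite cmat)) set) set)"
proof (rule inj_onI)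
  fix F F' :: "'x \<Rightarrow> ('e \<times> ('k cmat \<Rightarrow>\<^sub>L 'n cmat)) set"
  assume F: "F \<in> lifts P X f" and F': "F' \<in> lifts P X f"
    and eq: "embedding_of_lift P X f F = embedding_of_lift P X f F'"
  have "F x = F' x" if x: "x \<in> topspace X" for x
  proof -
    obtain e where e: "e \<in> topspace (tot P)" "prj P e = f x" using point_over[OF x] .
    obtain h where h: "h \<in> Fr" "F x = H_class P e h" using lift_class[OF F x e] .
    obtain h' where h': "h' \<in> Fr" "F' x = H_class P e h'" using lift_class[OF F' x e] .
    have "h a = h' a" for a
      using embedding_of_lift_class[OF x e h(1), of F a] embedding_of_lift_class[OF x e h'(1), of F' a]
        h h' eq by simp
    then show ?thesis using h h' blinfun_eqI by metis
  qed
  then show "F = F'"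
    using F F' unfolding lifts_def by (auto intro: extensionalityI)
qed

text \<open>The listed pairs form a single orbit, because \<open>[e \<cdot> g, a] = [e, g a]\<close> turns the homomorphism \<open>h\<close>
  read at \<open>e\<close> into \<open>h \<circ> g\<close> when read at \<open>e \<cdot> g\<close>.\<close>

lemma lift_of_embedding_class:
  fixes \<mu> :: "'x \<times> ('e \<times> 'k cmat) set \<Rightarrow> 'x \<times> 'n::finite cmat"
  assumes \<mu>: "\<mu> \<in> fibrewise_embeddings P X f" and x: "x \<in> topspace X"
    and e: "e \<in> topspace (tot P)" "prj P e = f x"
  defines "h \<equiv> \<lambda>e. Blinfun (\<lambda>a. snd (\<mu> (x, A_class P e a)))"
  shows "h e \<in> Fr" "blinfun_apply (h e) = (\<lambda>a. snd (\<mu> (x, A_class P e a)))"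
    "lift_of_embedding P X f \<mu> x = H_class P e (h e)"
proof -
  interpret H: associated_bundle PU P "top_of_set (Fr :: ('k cmat \<Rightarrow>\<^sub>L 'n cmat) set)"
    "\<lambda>g h. h o\<^sub>L inv\<^bsub>PU\<^esub> g"
    by (rule associated_bundle_homomorphisms[OF principal_PU])
  have h: "h e \<in> Fr" "blinfun_apply (h e) = (\<lambda>a. snd (\<mu> (x, A_class P e a)))"
    if e: "e \<in> topspace (tot P)" "prj P e = f x" for e
  proof -
    have "(\<lambda>c. snd (\<mu> (x, c))) \<in> star_hom (A_fibre P (prj P e)) matrix_algebra"
      using \<mu> x e by (simp add: fibrewise_embeddings_def)
    then have "(\<lambda>a. snd (\<mu> (x, A_class P e a))) \<in> star_hom matrix_algebra matrix_algebra"
      using star_hom_A_fibre_iff[OF e(1), of "\<lambda>c. snd (\<mu> (x, c))"] by simp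
    then show "h e \<in> Fr" "blinfun_apply (h e) = (\<lambda>a. snd (\<mu> (x, A_class P e a)))"
      unfolding h_def by (rule Blinfun_in_Fr)+
  qed
  show "h e \<in> Fr" "blinfun_apply (h e) = (\<lambda>a. snd (\<mu> (x, A_class P e a)))"
    using h[OF e] .
  have act: "(act P e g, h (act P e g)) = (act P e g, h e o\<^sub>L inv\<^bsub>PU\<^esub> (inv\<^bsub>PU\<^esub> g))"
    if g: "g \<in> carrier PU" for g
  proof -
    have "act P e g \<in> topspace (tot P)" "prj P (act P e g) = f x"
      using A.act_in[OF e(1) g] A.act_prj[OF e(1) g] e by simp_all
    note hg = h(2)[OF this]
    have "h (act P e g) a = h e (g a)" for a
      using A.cls_act[OF e(1) _ g, of "g a"]
      by (simp add: hg h(2)[OF e] PU_inv_apply[OF g])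
    then have "h (act P e g) = h e o\<^sub>L g" by (intro blinfun_eqI) simp
    then show ?thesis by (simp only: A.inv_inv[OF g])
  qed
  have fibre: "e' \<in> topspace (tot P) \<and> prj P e' = f x \<longleftrightarrow> (\<exists>g\<in>carrier PU. e' = act P e g)" for e'
  proof
    assume e': "e' \<in> topspace (tot P) \<and> prj P e' = f x"
    then have "e' \<in> topspace (tot P)" "prj P e = prj P e'" using e(2) by simp_all
    then obtain g where "g \<in> carrier PU" "e' = act P e g" by (rule A.act_transitive[OF e(1)])
    then show "\<exists>g\<in>carrier PU. e' = act P e g" by blast
  next
    assume "\<exists>g\<in>carrier PU. e' = act P e g"
    then show "e' \<in> topspace (tot P) \<and> prj P e' = f x"
      using A.act_in[OF e(1)] A.act_prj[OF e(1)] e(2) by (elim bexE) (simp del: PU_simps)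
  qed
  have "lift_of_embedding P X f \<mu> x = {(e', h e') |e'. e' \<in> topspace (tot P) \<and> prj P e' = f x}"
    using x by (simp add: lift_of_embedding_def h_def)
  also have "\<dots> = {(act P e g, h (act P e g)) |g. g \<in> carrier PU}"
    unfolding fibre by blast
  also have "\<dots> = H_class P e (h e)"
    unfolding set_eq_iff H.mem_cls mem_Collect_eq using act by metis
  finally show "lift_of_embedding P X f \<mu> x = H_class P e (h e)" .
qed

text \<open>Over an open set with a section \<open>s\<close> of \<open>P\<close>, the lift is the class of \<open>s\<close> and a map to \<open>Fr\<close>, which
  is continuous because in finite dimensions continuity can be tested pointwise.\<close>

lemma continuous_map_lift_of_embedding:
  fixes \<mu> :: "'x \<times> ('e \<times> 'k cmat) set \<Rightarrow> 'x \<times> 'n::finite cmat"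
  assumes \<mu>: "\<mu> \<in> fibrewise_embeddings P X f"
  shows "continuous_map X (H_univ P) (lift_of_embedding P X f \<mu>)"
proof (rule continuous_map_locally)
  interpret H: associated_bundle PU P "top_of_set (Fr :: ('k cmat \<Rightarrow>\<^sub>L 'n cmat) set)"
    "\<lambda>g h. h o\<^sub>L inv\<^bsub>PU\<^esub> g"
    by (rule associated_bundle_homomorphisms[OF principal_PU])
  fix x0 assume x0: "x0 \<in> topspace X"
  obtain U s \<gamma> where s: "local_section PU P U s \<gamma>" and U: "f x0 \<in> U"
    using A.local_section_exists[OF f_in[OF x0]] by blast
  define W where "W = {x \<in> topspace X. f x \<in> U}"
  have W: "openin X W"
    using openin_continuous_map_preimage[OF f] s unfolding local_section_def W_def by blast
  let ?W = "subtopology X W"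
  have in_W: "x \<in> topspace X" "f x \<in> U" if "x \<in> topspace ?W" for x
    using that by (auto simp: W_def)
  have "continuous_map ?W (subtopology (bas P) U) f"
    by (intro continuous_map_into_subtopology continuous_map_from_subtopology[OF f])
      (use in_W in auto)
  moreover have "continuous_map (subtopology (bas P) U) (tot P) s"
    using s unfolding local_section_def by blast
  ultimately have "continuous_map ?W (tot P) (s \<circ> f)" by (rule continuous_map_compose)
  then have sf: "continuous_map ?W (tot P) (\<lambda>x. s (f x))" by (simp only: o_def)
  have e: "s (f x) \<in> topspace (tot P)" "prj P (s (f x)) = f x" if "x \<in> topspace ?W" for x
    using sf s that in_W[OF that] unfolding local_section_def continuous_map_def by auto
  define h where "h x = Blinfun (\<lambda>a. snd (\<mu> (x, A_class P (s (f x)) a)))" for x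
  have h: "h x \<in> Fr" "blinfun_apply (h x) = (\<lambda>a. snd (\<mu> (x, A_class P (s (f x)) a)))"
    "lift_of_embedding P X f \<mu> x = H_class P (s (f x)) (h x)" if "x \<in> topspace ?W" for x
    using lift_of_embedding_class[OF \<mu> in_W(1)[OF that] e[OF that]] unfolding h_def by auto
  have "continuous_map ?W euclidean (\<lambda>x. blinfun_apply (h x) a)" for a
  proof -
    have "continuous_map ?W (prod_topology (tot P) euclidean) (\<lambda>x. (s (f x), a))"
      using sf by (intro continuous_map_pairedI) auto
    from continuous_map_compose[OF this quotient_imp_continuous_map[OF A.quotient_map_cls]]
    have "continuous_map ?W (A_univ P) (\<lambda>x. A_class P (s (f x)) a)"
      by (simp add: o_def A_space)
    then have "continuous_map ?W (prod_topology X (A_univ P)) (\<lambda>x. (x, A_class P (s (f x)) a))"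
      by (intro continuous_map_pairedI) (simp_all add: continuous_map_from_subtopology)
    then have 1: "continuous_map ?W (A_pullback P X f) (\<lambda>x. (x, A_class P (s (f x)) a))"
      unfolding A_pullback_def
      by (rule continuous_map_into_subtopology) (use e A.assoc_prj_cls in auto)
    have "continuous_map (A_pullback P X f) (prod_topology X euclidean) \<mu>"
      using \<mu> by (simp add: fibrewise_embeddings_def)
    from continuous_map_compose[OF continuous_map_compose[OF 1 this] continuous_map_snd]
    have "continuous_map ?W euclidean (\<lambda>x. snd (\<mu> (x, A_class P (s (f x)) a)))"
      by (simp add: o_def)
    then show ?thesis by (rule continuous_map_eq) (simp add: h(2))
  qed
  then have "continuous_map ?W euclidean h" by (rule continuous_map_blinfun_componentwise)
  then have "continuous_map ?W (top_of_set Fr) h"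
    by (rule continuous_map_into_subtopology) (use h(1) in auto)
  with sf have "continuous_map ?W (prod_topology (tot P) (top_of_set Fr)) (\<lambda>x. (s (f x), h x))"
    by (intro continuous_map_pairedI)
  from continuous_map_compose[OF this quotient_imp_continuous_map[OF H.quotient_map_cls]]
  have "continuous_map ?W (H_univ P) (\<lambda>x. H_class P (s (f x)) (h x))"
    by (simp add: o_def H_univ_def)
  then have "continuous_map ?W (H_univ P) (lift_of_embedding P X f \<mu>)"
    by (rule continuous_map_eq) (simp only: h(3))
  then show "\<exists>W. openin X W \<and> x0 \<in> W \<and>
      continuous_map (subtopology X W) (H_univ P) (lift_of_embedding P X f \<mu>)"
    using W x0 U unfolding W_def by blast
qed

lemma lift_of_embedding_in:
  fixes \<mu> :: "'x \<times> ('e \<times> 'k cmat) set \<Rightarrow> 'x \<times> 'n::finite cmat"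
  assumes \<mu>: "\<mu> \<in> fibrewise_embeddings P X f"
  shows "lift_of_embedding P X f \<mu> \<in> lifts P X f"
proof -
  interpret H: associated_bundle PU P "top_of_set (Fr :: ('k cmat \<Rightarrow>\<^sub>L 'n cmat) set)"
    "\<lambda>g h. h o\<^sub>L inv\<^bsub>PU\<^esub> g"
    by (rule associated_bundle_homomorphisms[OF principal_PU])
  have "assoc_prj P (lift_of_embedding P X f \<mu> x) = f x" if x: "x \<in> topspace X" for x
  proof -
    obtain e where e: "e \<in> topspace (tot P)" "prj P e = f x" using point_over[OF x] .
    note l = lift_of_embedding_class[OF \<mu> x e]
    show ?thesis unfolding l(3) using H.assoc_prj_cls[OF e(1)] l(1) e(2) by simp
  qed
  then show ?thesis
    using continuous_map_lift_of_embedding[OF \<mu>]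
    by (simp add: lifts_def lift_of_embedding_def)
qed

lemma embedding_of_lift_of_embedding:
  fixes \<mu> :: "'x \<times> ('e \<times> 'k cmat) set \<Rightarrow> 'x \<times> 'n::finite cmat"
  assumes \<mu>: "\<mu> \<in> fibrewise_embeddings P X f"
  shows "embedding_of_lift P X f (lift_of_embedding P X f \<mu>) = \<mu>"
proof (rule extensionalityI[of _ "topspace (A_pullback P X f)"])
  fix z assume z: "z \<in> topspace (A_pullback P X f)"
  obtain x e a where x: "x \<in> topspace X" and e: "e \<in> topspace (tot P)" "prj P e = f x"
    and z_eq: "z = (x, A_class P e a)"
    using pullback_cases[OF z] .
  note l = lift_of_embedding_class[OF \<mu> x e]
  have "fst (\<mu> z) = x" using \<mu> z z_eq by (simp add: fibrewise_embeddings_def)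
  moreover have "embedding_of_lift P X f (lift_of_embedding P X f \<mu>) z = (x, snd (\<mu> z))"
    unfolding z_eq using embedding_of_lift_class[OF x e l(1), of "lift_of_embedding P X f \<mu>"] l(2,3)
    by simp
  ultimately show "embedding_of_lift P X f (lift_of_embedding P X f \<mu>) z = \<mu> z"
    by (simp add: prod_eq_iff)
qed (use \<mu> in \<open>simp_all add: embedding_of_lift_def fibrewise_embeddings_def\<close>)

lemma bij_betw_embedding_of_lift:
  "bij_betw (embedding_of_lift P X f)
     (lifts P X f :: ('x \<Rightarrow> ('e \<times> ('k cmat \<Rightarrow>\<^sub>L 'n::finite cmat)) set) set)
     (fibrewise_embeddings P X f)"
proof (rule bij_betw_imageI[OF embedding_of_lift_inj])
  show "embedding_of_lift P X f ` lifts P X f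
    = (fibrewise_embeddings P X f :: ('x \<times> ('e \<times> 'k cmat) set \<Rightarrow> 'x \<times> 'n cmat) set)"
  proof (intro equalityI subsetI)
    fix \<mu> :: "'x \<times> ('e \<times> 'k cmat) set \<Rightarrow> 'x \<times> 'n cmat"
    assume "\<mu> \<in> fibrewise_embeddings P X f"
    then show "\<mu> \<in> embedding_of_lift P X f ` lifts P X f"
      by (metis embedding_of_lift_of_embedding lift_of_embedding_in imageI)
  qed (use embedding_of_lift_in in blast)
qed

end

lemma lift_compose:
  assumes F: "F \<in> lifts P X f" and \<phi>: "continuous_map Y X \<phi>"
  shows "restrict (F \<circ> \<phi>) (topspace Y) \<in> lifts P Y (f \<circ> \<phi>)"
proof -
  have "continuous_map Y (H_univ P) (F \<circ> \<phi>)"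
    using F \<phi> by (auto simp: lifts_def intro: continuous_map_compose)
  then have "continuous_map Y (H_univ P) (restrict (F \<circ> \<phi>) (topspace Y))"
    by (rule continuous_map_eq) simp
  moreover have "\<phi> y \<in> topspace X" if "y \<in> topspace Y" for y
    using continuous_map_image_subset_topspace[OF \<phi>] that by blast
  ultimately show ?thesis using F by (simp add: lifts_def)
qed

lemma embedding_of_lift_compose:
  assumes \<phi>: "continuous_map Y X \<phi>"
  shows "embedding_of_lift P Y (f \<circ> \<phi>) (restrict (F \<circ> \<phi>) (topspace Y)) =
    pullback_embedding P Y f \<phi> (embedding_of_lift P X f F)"
proof -
  have "\<phi> y \<in> topspace X" if "y \<in> topspace Y" for y
    using continuous_map_image_subset_topspace[OF \<phi>] that by blast
  then show ?thesis
    unfolding embedding_of_lift_def pullback_embedding_def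
    by (intro restrict_ext) (auto simp: topspace_A_pullback)
qed

theorem proposition1:
  fixes k l :: nat
    and P :: "('k::finite, 'e, 'b) PU_bundle"
    and X :: "'x topology" and f :: "'x \<Rightarrow> 'b"
  assumes "k \<ge> 1" and "l \<ge> 1"
    and "CARD('k) = k" and "CARD('n::finite) = k * l"
    and "universal_bundle PU P"
    and "compact_manifold X \<or> finite_CW_complex X"
    and "continuous_map X (bas P) f"
  shows "bij_betw (embedding_of_lift P X f)
           (lifts P X f :: ('x \<Rightarrow> ('e \<times> ('k cmat \<Rightarrow>\<^sub>L 'n cmat)) set) set)
           (fibrewise_embeddings P X f) \<and>
         (\<forall>(Y :: 'y topology) \<phi>.
           (compact_manifold Y \<or> finite_CW_complex Y) \<longrightarrow> continuous_map Y X \<phi> \<longrightarrow>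
           (\<forall>F \<in> (lifts P X f :: ('x \<Rightarrow> ('e \<times> ('k cmat \<Rightarrow>\<^sub>L 'n cmat)) set) set).
              restrict (F \<circ> \<phi>) (topspace Y) \<in> lifts P Y (f \<circ> \<phi>) \<and>
              embedding_of_lift P Y (f \<circ> \<phi>) (restrict (F \<circ> \<phi>) (topspace Y)) =
                pullback_embedding P Y f \<phi> (embedding_of_lift P X f F)))"
proof -
  have "principal_bundle PU P"
    using \<open>universal_bundle PU P\<close> by (simp add: universal_bundle_def)
  then interpret PU_principal_map P X f
    using \<open>continuous_map X (bas P) f\<close>
    by (intro PU_principal_map.intro PU_principal.intro PU_principal_map_axioms.intro)
  show ?thesis
    using bij_betw_embedding_of_lift lift_compose embedding_of_lift_compose by blast
qed

end
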